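(* As $n\to\infty$, $$\sigma_{od}\mathrm{moex}(n) \sim \frac{3\,e^{\pi\sqrt{n/2}}}{4\sqrt{2}\,n}.$$
   Context: For $n\ge 0$, $\mathcal{P}_{od}(n)$ is the set of all partitions of $n$ in which no odd part is repeated (even parts may appear with any multiplicity). For $\lambda\in\mathcal{P}_{od}(n)$, $\mathrm{moex}(\lambda)$ is the smallest positive odd integer that is not a part of $\lambda$. Define $\sigma_{od}\mathrm{moex}(n):=\sum_{\lambda\in\mathcal{P}_{od}(n)}\mathrm{moex}(\lambda)$. Here $f(n)\sim g(n)$ means $f(n)/g(n)\to 1$ as $n\to\infty$. *)

theory Defs
  imports Complex_Main "HOL-Library.Multiset" "HOL-Library.Landau_Symbols"
begin

text \<open>A partition is represented by the multiset of its parts.\<close>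

definition partitions_of :: "nat \<Rightarrow> nat multiset set" where
  "partitions_of n = {p. (\<forall>k \<in># p. 0 < k) \<and> sum_mset p = n}"

definition P_od :: "nat \<Rightarrow> nat multiset set" where
  "P_od n = {p \<in> partitions_of n. \<forall>k. odd k \<longrightarrow> count p k \<le> 1}"

definition moex :: "nat multiset \<Rightarrow> nat" where
  "moex p = (LEAST k. odd k \<and> k \<notin># p)"

definition sigma_od_moex :: "nat \<Rightarrow> nat" where
  "sigma_od_moex n = (\<Sum>p \<in> P_od n. moex p)"

text \<open>The sum above is not vacuous: \<open>P_od n\<close> is finite.\<close>

lemma size_le_sum_mset:
  fixes p :: "nat multiset"
  assumes "\<forall>k \<in># p. 0 < k"
  shows "size p \<le> sum_mset p"
  using assms by (induction p) auto

lemma finite_partitions_of: "finite (partitions_of n)"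
proof (rule finite_subset)
  show "partitions_of n \<subseteq> mset ` {xs. set xs \<subseteq> {..n} \<and> length xs \<le> n}"
  proof
    fix p assume p: "p \<in> partitions_of n"
    obtain xs where xs: "mset xs = p" using ex_mset by blast
    have "length xs \<le> n"
      using p size_le_sum_mset[of p] xs by (auto simp: partitions_of_def)
    moreover have "set xs \<subseteq> {..n}"
      using p xs by (auto simp: partitions_of_def sum_mset_sum_list dest: member_le_sum_list)
    ultimately show "p \<in> mset ` {xs. set xs \<subseteq> {..n} \<and> length xs \<le> n}"
      using xs by blast
  qed
  show "finite (mset ` {xs. set xs \<subseteq> {..n} \<and> length xs \<le> n})"
    by (intro finite_imageI finite_lists_length_le) simp
qed

lemma finite_P_od: "finite (P_od n)"
  by (rule finite_subset[OF _ finite_partitions_of[of n]]) (auto simp: P_od_def)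

end

theory Submission
  imports Defs "HOL-Probability.Probability" "HOL-Complex_Analysis.Complex_Analysis" "HOL-Real_Asymp.Real_Asymp"
begin

text \<open>
  Let \<open>F\<^sub>m(q) = \<Prod> q\<^bsup>2j-1\<^esup> (j \<le> m) \<cdot> \<Prod> (1 + q\<^bsup>2j-1\<^esup>) (j > m) / \<Prod> (1 - q\<^bsup>2k\<^esup>)\<close> count the
  partitions in which no odd part is repeated and all of \<open>1, 3, \<dots>, 2m-1\<close> occur. Since \<open>moex\<close> is one plus twice the
  number of \<open>m \<ge> 1\<close> for which these parts occur, the generating function of the \<open>moex\<close> sums is
  \<open>F\<^sub>0 + 2 \<Sum> F\<^sub>m (m \<ge> 1)\<close>. As \<open>q \<rightarrow> 1\<close>, \<open>F\<^sub>m / F\<^sub>0\<close> tends to \<open>2\<^bsup>-m\<^esup>\<close> and is bounded by it, so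
  this sum behaves like \<open>3 F\<^sub>0\<close>.

  With \<open>P = \<Prod> 1 / (1 - q\<^bsup>k\<^esup>)\<close> one has \<open>F\<^sub>0(q) = P(q) P(q\<^bsup>4\<^esup>) / P(q\<^bsup>2\<^esup>)\<close>. The behaviour of \<open>P(exp (-t))\<close>
  up to a factor \<open>1 + o(1)\<close> follows by dividing out the product for \<open>sinh (pi / t)\<close>: what remains is a sum
  \<open>\<Sum> f (k t)\<close> with \<open>f\<close> regular at 0, to which the trapezoidal rule applies, and the leading coefficient
  \<open>pi\<^sup>2 / 6\<close> is read off from the Lambert series of \<open>ln P\<close>. Hence
  \<open>F\<^sub>0(exp (-t)) \<sim> sqrt (t / pi) exp (pi\<^sup>2 / (8 t))\<close>.

  The coefficients are then obtained by the saddle point method. Only the asymptotics on the real axis are needed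
  near the saddle point, because Vitali's theorem transports them to complex arguments; away from it the factors of the
  product give \<open>|F\<^sub>m(q)| \<le> F\<^sub>m(|q|) exp (- |q|\<^bsup>2m+1\<^esup> (1 / (1 - |q|) - 1 / |1 - q|) / 4)\<close>.
\<close>

section \<open>Limits and rearrangement of series\<close>

lemma tendsto_suminf_dominated:
  fixes f :: "nat \<Rightarrow> 'b \<Rightarrow> 'a :: {real_normed_algebra, banach}"
  assumes lim: "\<And>k. (f k \<longlongrightarrow> g k) F"
    and bound: "eventually (\<lambda>x. \<forall>k. norm (f k x) \<le> h k) F"
    and "summable h" "F \<noteq> bot"
  shows "((\<lambda>x. \<Sum>k. f k x) \<longlongrightarrow> (\<Sum>k. g k)) F"
proof -
  have "eventually (\<lambda>(k, x). norm (f k x) \<le> h k) (at_top \<times>\<^sub>F F)"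
    by (rule eventually_mono[OF eventually_prodI[OF always_eventually[of "\<lambda>_. True"] bound]]) auto
  thus ?thesis using tannerys_theorem[of f g F h] assms by blast
qed

lemma sums_swap:
  fixes f :: "nat \<Rightarrow> nat \<Rightarrow> 'a :: banach"
  assumes row_norms: "\<And>k. (\<lambda>m. norm (f k m)) sums N k" and summable_norms: "summable N"
    and rows: "\<And>k. f k sums a k" and columns: "\<And>m. (\<lambda>k. f k m) sums b m"
  shows "summable a" and "b sums (\<Sum>k. a k)"
proof -
  have norm_le_row: "norm (f k m) \<le> N k" for k m
    using sum_le_suminf[of "\<lambda>m. norm (f k m)" "{m}"] row_norms[of k] by (simp add: sums_iff)
  hence N_nonneg: "0 \<le> N k" for k
    using order_trans[OF norm_ge_zero] by blast
  have "(\<lambda>(k, m). norm (f k m)) summable_on UNIV \<times> UNIV"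
  proof (rule summable_on_SigmaI)
    show "((\<lambda>m. case (k, m) of (k, m) \<Rightarrow> norm (f k m)) has_sum N k) UNIV" for k
      using sums_nonneg_imp_has_sum[OF row_norms[of k]] by simp
    show "N summable_on UNIV"
      using summable_norms N_nonneg by (intro summable_nonneg_imp_summable_on)
  qed simp
  hence "(\<lambda>(k, m). f k m) summable_on UNIV \<times> UNIV"
    using abs_summable_summable[of "\<lambda>(k, m). f k m"] by (simp add: case_prod_unfold)
  then obtain L where L: "((\<lambda>(k, m). f k m) has_sum L) (UNIV \<times> UNIV)"
    unfolding summable_on_def by blast
  have "a sums L"
    using has_sum_imp_sums[OF has_sum_SigmaD[OF L, of a]]
      norm_summable_imp_has_sum[OF sums_summable[OF row_norms] rows] by simp
  thus "summable a" by (rule sums_summable)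
  have summable_columns: "summable (\<lambda>k. norm (f k m))" for m
    by (rule summable_comparison_test[OF _ summable_norms]) (use norm_le_row in auto)
  have "((\<lambda>(m, k). f k m) has_sum L) (UNIV \<times> UNIV)"
    using L by (subst (asm) has_sum_swap) simp
  hence "b sums L"
    using has_sum_imp_sums[OF has_sum_SigmaD[of "\<lambda>(m, k). f k m" UNIV "\<lambda>_. UNIV" L b]]
      norm_summable_imp_has_sum[OF summable_columns columns] by simp
  thus "b sums (\<Sum>k. a k)" using \<open>a sums L\<close> by (simp add: sums_iff)
qed

section \<open>Trapezoidal sums\<close>

text \<open>Comparing the steps \<open>t\<close> and \<open>2 t\<close> avoids the integral of \<open>f\<close>: the midpoint errors telescope against \<open>g\<close>.\<close>

locale trapezoidal_sum =
  fixes f f' g S :: "real \<Rightarrow> real" and a b :: real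
  assumes continuous: "continuous_on {0..} f"
    and deriv: "\<And>x. 0 < x \<Longrightarrow> (f has_real_derivative f' x) (at x)"
    and deriv_increment: "\<And>x y. 0 < x \<Longrightarrow> x \<le> y \<Longrightarrow> \<bar>f' y - f' x\<bar> \<le> g y - g x"
    and g_lower: "\<And>x. 0 < x \<Longrightarrow> a \<le> g x" and g_upper: "\<And>x. 0 < x \<Longrightarrow> g x \<le> b"
    and sums: "\<And>t. 0 < t \<Longrightarrow> (\<lambda>k. f (real (Suc k) * t)) sums S t"
begin

definition variation :: "real \<Rightarrow> real" where
  "variation x = (if x \<le> 0 then a else g x)"

lemma variation_bounds:
  shows "a \<le> variation x" and "variation x \<le> b"
  using g_lower[of x] g_upper[of x] order_trans[OF g_lower[of 1] g_upper[of 1]]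
  by (auto simp: variation_def)

lemma variation_mono: "x \<le> y \<Longrightarrow> variation x \<le> variation y"
  using deriv_increment[of x y] g_lower[of y] by (auto simp: variation_def)

lemma mean_value:
  assumes "0 \<le> x" "0 < h"
  obtains z where "x < z" "z < x + h" "f (x + h) - f x = h * f' z"
proof -
  have "\<exists>z. x < z \<and> z < x + h \<and> f (x + h) - f x = (\<lambda>v. f' z * v) (x + h - x)"
  proof (rule mvt[of x "x + h" f "\<lambda>z v. f' z * v"])
    show "continuous_on {x..x + h} f"
      by (rule continuous_on_subset[OF continuous]) (use assms in auto)
    show "(f has_derivative (\<lambda>v. f' z * v)) (at z)" if "x < z" for z
      using deriv[of z] that assms by (simp add: has_field_derivative_def)
  qed (use assms in auto)
  thus thesis using that by (auto simp: mult.commute)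
qed

lemma midpoint_error:
  assumes "0 \<le> x" "0 < h"
  shows "\<bar>f (x + h) - (f x + f (x + 2 * h)) / 2\<bar> \<le> h / 2 * (variation (x + 2 * h) - variation x)"
proof -
  obtain y where y: "x < y" "y < x + h" "f (x + h) - f x = h * f' y"
    by (rule mean_value[OF assms])
  obtain z where z: "x + h < z" "z < x + h + h" "f (x + h + h) - f (x + h) = h * f' z"
    using mean_value[of "x + h" h] assms by auto
  have "f (x + h) - (f x + f (x + 2 * h)) / 2 = ((f (x + h) - f x) - (f (x + h + h) - f (x + h))) / 2"
    by (simp add: field_simps)
  also have "\<dots> = - (h / 2 * (f' z - f' y))"
    unfolding y(3) z(3) by (simp add: algebra_simps diff_divide_distrib)
  also have "\<bar>\<dots>\<bar> = h / 2 * \<bar>f' z - f' y\<bar>" using assms by (simp add: abs_mult)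
  also have "\<dots> \<le> h / 2 * (variation z - variation y)"
    using deriv_increment[of y z] y z assms by (intro mult_left_mono) (auto simp: variation_def)
  also have "\<dots> \<le> h / 2 * (variation (x + 2 * h) - variation x)"
    using y z assms by (intro mult_left_mono diff_mono variation_mono) auto
  finally show ?thesis .
qed

definition trapezoid :: "real \<Rightarrow> real" where
  "trapezoid t = t * (f 0 / 2 + S t)"

lemma midpoint_errors_sums:
  assumes "0 < s"
  shows "(\<lambda>n. f (real n * (2 * s) + s) - (f (real n * (2 * s)) + f (real n * (2 * s) + 2 * s)) / 2)
           sums (S s - 2 * S (2 * s) - f 0 / 2)"
proof -
  have pairs: "(\<lambda>n. f (real n * (2 * s) + s) + f (real (Suc n) * (2 * s))) sums S s"
    using sums_group[OF sums[OF assms], of 2] by (simp add: numeral_2_eq_2 algebra_simps)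
  have right: "(\<lambda>n. f (real (Suc n) * (2 * s))) sums S (2 * s)"
    using sums assms by simp
  hence left: "(\<lambda>n. f (real n * (2 * s))) sums (S (2 * s) + f 0)"
    by (subst (asm) sums_Suc_iff) simp
  have "(\<lambda>n. (f (real n * (2 * s) + s) + f (real (Suc n) * (2 * s)))
         - (f (real n * (2 * s)) + 3 * f (real (Suc n) * (2 * s))) / 2)
       sums (S s - ((S (2 * s) + f 0) + 3 * S (2 * s)) / 2)"
    by (intro sums_diff sums_divide sums_add sums_mult pairs left right)
  thus ?thesis by (simp add: algebra_simps add_divide_distrib)
qed

lemma trapezoid_double:
  assumes "0 < s"
  shows "\<bar>trapezoid s - trapezoid (2 * s)\<bar> \<le> s\<^sup>2 * ((b - a) / 2)"
proof -
  define e where "e n = f (real n * (2 * s) + s) - (f (real n * (2 * s)) + f (real n * (2 * s) + 2 * s)) / 2"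
    for n
  have partial: "\<bar>\<Sum>n<N. e n\<bar> \<le> s * ((b - a) / 2)" for N
  proof -
    have "\<bar>\<Sum>n<N. e n\<bar> \<le> (\<Sum>n<N. s / 2 * (variation (real n * (2 * s) + 2 * s) - variation (real n * (2 * s))))"
      unfolding e_def using assms by (intro order_trans[OF sum_abs] sum_mono midpoint_error) auto
    also have "\<dots> = s / 2 * (\<Sum>n<N. variation (real (Suc n) * (2 * s)) - variation (real n * (2 * s)))"
      by (simp add: sum_distrib_left algebra_simps)
    also have "\<dots> = s / 2 * (variation (real N * (2 * s)) - variation (real 0 * (2 * s)))"
      by (subst sum_lessThan_telescope) simp
    also have "\<dots> \<le> s / 2 * (b - a)"
      using assms by (intro mult_left_mono diff_mono variation_bounds) auto
    finally show ?thesis by simp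
  qed
  have "(\<lambda>N. \<bar>\<Sum>n<N. e n\<bar>) \<longlonglongrightarrow> \<bar>S s - 2 * S (2 * s) - f 0 / 2\<bar>"
    using midpoint_errors_sums[OF assms] unfolding e_def sums_def by (rule tendsto_rabs)
  hence "\<bar>S s - 2 * S (2 * s) - f 0 / 2\<bar> \<le> s * ((b - a) / 2)"
    using partial by (intro tendsto_upperbound) (auto intro: always_eventually)
  hence "s * \<bar>S s - 2 * S (2 * s) - f 0 / 2\<bar> \<le> s * (s * ((b - a) / 2))"
    using assms by (intro mult_left_mono) auto
  moreover have "trapezoid s - trapezoid (2 * s) = s * (S s - 2 * S (2 * s) - f 0 / 2)"
    by (simp add: trapezoid_def algebra_simps)
  ultimately show ?thesis
    using assms by (simp add: abs_mult power2_eq_square mult.assoc)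
qed

lemma trapezoid_dyadic:
  assumes "0 < t"
  shows "\<bar>trapezoid t - trapezoid (t / 2 ^ n)\<bar> \<le> t\<^sup>2 * ((b - a) / 6) * (1 - 1 / 4 ^ n)"
proof (induction n)
  case (Suc n)
  have "\<bar>trapezoid (t / 2 ^ Suc n) - trapezoid (2 * (t / 2 ^ Suc n))\<bar> \<le> (t / 2 ^ Suc n)\<^sup>2 * ((b - a) / 2)"
    using assms by (intro trapezoid_double) auto
  also have "(t / 2 ^ Suc n)\<^sup>2 = t\<^sup>2 / (4 * 4 ^ n)"
  proof -
    have "((2::real) ^ Suc n)\<^sup>2 = 4 * 4 ^ n"
      by (simp only: power_mult[symmetric] mult.commute[of "Suc n"]) (simp add: power_mult)
    thus ?thesis by (simp only: power_divide)
  qed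
  finally have "\<bar>trapezoid (t / 2 ^ Suc n) - trapezoid (t / 2 ^ n)\<bar> \<le> t\<^sup>2 * ((b - a) / 6) * (3 / (4 * 4 ^ n))"
    by (simp add: mult.commute)
  hence "\<bar>trapezoid t - trapezoid (t / 2 ^ Suc n)\<bar>
      \<le> t\<^sup>2 * ((b - a) / 6) * (1 - 1 / 4 ^ n) + t\<^sup>2 * ((b - a) / 6) * (3 / (4 * 4 ^ n))"
    using Suc.IH by linarith
  also have "\<dots> = t\<^sup>2 * ((b - a) / 6) * (1 - 1 / 4 ^ Suc n)" by (simp add: field_simps)
  finally show ?case .
qed simp

theorem trapezoid_error:
  assumes "0 < t" and leading: "((\<lambda>t. t * S t) \<longlongrightarrow> L) (at_right 0)"
  shows "\<bar>trapezoid t - L\<bar> \<le> t\<^sup>2 * ((b - a) / 6)"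
proof -
  have "((\<lambda>t. t * (f 0 / 2) + t * S t) \<longlongrightarrow> 0 * (f 0 / 2) + L) (at_right 0)"
    by (intro tendsto_intros leading)
  hence "(trapezoid \<longlongrightarrow> L) (at_right 0)"
    by (simp add: trapezoid_def[abs_def] distrib_left)
  moreover have "filterlim (\<lambda>n. t / 2 ^ n) (at_right 0) sequentially"
    using assms by real_asymp
  ultimately have "(\<lambda>n. trapezoid (t / 2 ^ n)) \<longlonglongrightarrow> L"
    by (rule filterlim_compose)
  hence "(\<lambda>n. \<bar>trapezoid t - trapezoid (t / 2 ^ n)\<bar>) \<longlonglongrightarrow> \<bar>trapezoid t - L\<bar>"
    by (intro tendsto_intros)
  moreover have "\<bar>trapezoid t - trapezoid (t / 2 ^ n)\<bar> \<le> t\<^sup>2 * ((b - a) / 6)" for n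
    using order_trans[OF variation_bounds(1) variation_bounds(2)]
    by (intro order_trans[OF trapezoid_dyadic[OF assms(1)] mult_left_le] mult_nonneg_nonneg) auto
  ultimately show ?thesis by (intro tendsto_upperbound) (auto intro: always_eventually)
qed

corollary tendsto_sum_minus_leading_term:
  assumes leading: "((\<lambda>t. t * S t) \<longlongrightarrow> L) (at_right 0)"
  shows "((\<lambda>t. S t - L / t) \<longlongrightarrow> - f 0 / 2) (at_right 0)"
proof -
  have "((\<lambda>t. f 0 / 2 + S t - L / t) \<longlongrightarrow> 0) (at_right 0)"
  proof (rule Lim_null_comparison)
    show "eventually (\<lambda>t. norm (f 0 / 2 + S t - L / t) \<le> t * ((b - a) / 6)) (at_right 0)"
      using eventually_at_right_less[of 0]
    proof eventually_elim
      case (elim t)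
      have "t * (f 0 / 2 + S t - L / t) = trapezoid t - L"
        using elim by (simp add: trapezoid_def algebra_simps)
      hence "t * \<bar>f 0 / 2 + S t - L / t\<bar> = \<bar>trapezoid t - L\<bar>"
        using elim by (metis abs_mult abs_of_pos)
      also have "\<dots> \<le> t * (t * ((b - a) / 6))"
        using trapezoid_error[OF elim leading] by (simp add: power2_eq_square mult.assoc)
      finally show ?case using elim by simp
    qed
    have "((\<lambda>t. t * ((b - a) / 6)) \<longlongrightarrow> 0 * ((b - a) / 6)) (at_right 0)"
      by (intro tendsto_intros)
    thus "((\<lambda>t. t * ((b - a) / 6)) \<longlongrightarrow> 0) (at_right 0)" by simp
  qed
  from tendsto_diff[OF this tendsto_const[of "f 0 / 2"]] show ?thesis
    by (simp add: algebra_simps)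
qed

end

section \<open>The partition product on the real axis\<close>

lemma minus_ln_one_minus_bounds:
  fixes x :: real
  assumes "0 \<le> x" "x < 1"
  shows "0 \<le> - ln (1 - x)" "- ln (1 - x) \<le> x / (1 - x)"
proof -
  show "0 \<le> - ln (1 - x)" using assms by simp
  have "ln (1 / (1 - x)) \<le> 1 / (1 - x) - 1"
    using assms by (intro ln_le_minus_one) auto
  thus "- ln (1 - x) \<le> x / (1 - x)" using assms by (simp add: ln_div field_simps)
qed

lemma minus_ln_one_minus_sums:
  fixes x :: real
  assumes "0 \<le> x" "x < 1"
  shows "(\<lambda>m. x ^ Suc m / real (Suc m)) sums (- ln (1 - x))"
proof -
  have "(\<lambda>m. x ^ m / real m) sums (- ln (1 - x))"
    using sums_minus[OF ln_series'[of "- x"]] assms by simp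
  thus ?thesis by (subst sums_Suc_iff) simp
qed

definition ln_partition_gf :: "real \<Rightarrow> real" where
  "ln_partition_gf t = (\<Sum>k. - ln (1 - exp (- (real (Suc k) * t))))"

lemma exp_minus_mult_eq_power: "exp (- (real k * t)) = exp (- t) ^ k"
  by (metis exp_of_nat_mult mult_minus_right)

lemma ln_partition_gf_sums:
  assumes "0 < t"
  shows "(\<lambda>k. - ln (1 - exp (- (real (Suc k) * t)))) sums ln_partition_gf t"
  unfolding ln_partition_gf_def
proof (rule summable_sums, rule summable_comparison_test)
  define r where "r = exp (- t)"
  have r: "0 < r" "r < 1" using assms by (auto simp: r_def)
  show "\<exists>N. \<forall>n\<ge>N. norm (- ln (1 - exp (- (real (Suc n) * t)))) \<le> (r / (1 - r)) * r ^ n"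
  proof (intro exI allI impI)
    fix n :: nat
    have le: "r ^ Suc n \<le> r" using r power_decreasing[of 1 "Suc n" r] by simp
    hence lt: "r ^ Suc n < 1" using r by linarith
    have "- ln (1 - r ^ Suc n) \<le> r ^ Suc n / (1 - r ^ Suc n)"
      using r lt by (intro minus_ln_one_minus_bounds) auto
    also have "\<dots> \<le> r ^ Suc n / (1 - r)" using r le lt by (intro divide_left_mono mult_pos_pos) auto
    finally show "norm (- ln (1 - exp (- (real (Suc n) * t)))) \<le> (r / (1 - r)) * r ^ n"
      using minus_ln_one_minus_bounds(1)[of "r ^ Suc n"] r lt
      unfolding exp_minus_mult_eq_power[of "Suc n" t, folded r_def] by simp
  qed
  show "summable (\<lambda>n. (r / (1 - r)) * r ^ n)" using r by (intro summable_mult summable_geometric) auto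
qed

lemma ln_partition_gf_Lambert_sums:
  assumes "0 < t"
  shows "(\<lambda>m. 1 / (real (Suc m) * (exp (real (Suc m) * t) - 1))) sums ln_partition_gf t"
proof -
  define f where "f k m = exp (- (real (Suc k) * t)) ^ Suc m / real (Suc m)" for k m
  have f_nonneg: "norm (f k m) = f k m" for k m
    by (simp add: f_def)
  have rows: "f k sums (- ln (1 - exp (- (real (Suc k) * t))))" for k
    unfolding f_def using assms by (intro minus_ln_one_minus_sums) auto
  have columns: "(\<lambda>k. f k m) sums (1 / (real (Suc m) * (exp (real (Suc m) * t) - 1)))" for m
  proof -
    define y where "y = exp (- (real (Suc m) * t))"
    have y: "0 < y" "y < 1" using assms by (auto simp: y_def)
    have "(\<lambda>k. y * y ^ k / real (Suc m)) sums (y * (1 / (1 - y)) / real (Suc m))"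
      using y by (intro sums_mult sums_divide geometric_sums) auto
    moreover have "f k m = y * y ^ k / real (Suc m)" for k
      unfolding f_def y_def exp_minus_mult_eq_power by (metis mult.commute power_Suc power_mult)
    moreover have "y * (1 / (1 - y)) / real (Suc m) = 1 / (real (Suc m) * (exp (real (Suc m) * t) - 1))"
    proof -
      have "exp (real (Suc m) * t) = 1 / y"
        unfolding y_def by (simp add: exp_minus inverse_eq_divide del: of_nat_Suc)
      thus ?thesis using y by (simp only:) (simp add: divide_simps)
    qed
    ultimately show ?thesis by simp
  qed
  show ?thesis
    using sums_swap(2)[of f, unfolded f_nonneg, OF rows _ rows columns] ln_partition_gf_sums[OF assms]
    by (simp add: ln_partition_gf_def sums_summable)
qed

lemma tendsto_mult_ln_partition_gf: "((\<lambda>t. t * ln_partition_gf t) \<longlongrightarrow> pi\<^sup>2 / 6) (at_right 0)"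
proof -
  define a where "a m t = t / (real (Suc m) * (exp (real (Suc m) * t) - 1))" for m t
  have "((\<lambda>t. \<Sum>m. a m t) \<longlongrightarrow> (\<Sum>m. 1 / (real (m + 1))\<^sup>2)) (at_right 0)"
  proof (rule tendsto_suminf_dominated)
    show "(a m \<longlongrightarrow> 1 / (real (m + 1))\<^sup>2) (at_right 0)" for m
    proof -
      have "(a m \<longlongrightarrow> inverse (1 + real m) * inverse (1 + real m)) (at_right 0)"
        unfolding a_def[abs_def] by real_asymp
      thus ?thesis by (simp add: power2_eq_square inverse_eq_divide add.commute)
    qed
    show "\<forall>\<^sub>F t in at_right 0. \<forall>m. norm (a m t) \<le> 1 / (real (m + 1))\<^sup>2"
    proof (rule eventually_mono[OF eventually_at_right_less[of 0]], rule allI)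
      fix t :: real and m assume "0 < t"
      have "real (Suc m) * t \<le> exp (real (Suc m) * t) - 1"
        using exp_ge_add_one_self[of "real (Suc m) * t"] by linarith
      hence "a m t \<le> t / (real (Suc m) * (real (Suc m) * t))"
        unfolding a_def using \<open>0 < t\<close> by (intro divide_left_mono mult_left_mono mult_pos_pos) auto
      thus "norm (a m t) \<le> 1 / (real (m + 1))\<^sup>2"
        using \<open>0 < t\<close> by (simp add: a_def power2_eq_square)
    qed
    show "summable (\<lambda>m. 1 / (real (m + 1))\<^sup>2)" using inverse_squares_sums by (simp add: sums_iff)
  qed simp
  also have "(\<Sum>m. 1 / (real (m + 1))\<^sup>2) = pi\<^sup>2 / 6"
    using inverse_squares_sums by (simp add: sums_iff)
  finally show ?thesis
  proof (rule Lim_transform_eventually)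
    show "\<forall>\<^sub>F t in at_right 0. (\<Sum>m. a m t) = t * ln_partition_gf t"
      using eventually_at_right_less[of 0]
    proof eventually_elim
      case (elim t)
      from sums_mult[OF ln_partition_gf_Lambert_sums[OF elim], of t] show ?case
        by (simp add: a_def sums_iff)
    qed
  qed
qed

lemma tendsto_prod_one_minus_power:
  assumes "0 < t"
  shows "(\<lambda>n. \<Prod>k=1..n. 1 - exp (- t) ^ k) \<longlonglongrightarrow> exp (- ln_partition_gf t)"
proof -
  have "exp (- (\<Sum>k<n. - ln (1 - exp (- (real (Suc k) * t))))) = (\<Prod>k=1..n. 1 - exp (- t) ^ k)" for n
  proof -
    have "exp (- (\<Sum>k<n. - ln (1 - exp (- (real (Suc k) * t)))))
        = (\<Prod>k<n. exp (ln (1 - exp (- (real (Suc k) * t)))))"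
      by (simp add: sum_negf exp_sum)
    also have "\<dots> = (\<Prod>k<n. 1 - exp (- t) ^ Suc k)"
      using assms by (intro prod.cong) (auto simp: exp_minus_mult_eq_power[symmetric] simp del: power_Suc)
    also have "\<dots> = (\<Prod>k=1..n. 1 - exp (- t) ^ k)"
      by (rule prod.reindex_bij_witness[of _ "\<lambda>k. k - 1" Suc]) auto
    finally show ?thesis .
  qed
  moreover have "(\<lambda>n. exp (- (\<Sum>k<n. - ln (1 - exp (- (real (Suc k) * t)))))) \<longlonglongrightarrow> exp (- ln_partition_gf t)"
    using ln_partition_gf_sums[OF assms] unfolding sums_def by (intro tendsto_intros)
  ultimately show ?thesis by (simp only:)
qed

lemma sinh_product_formula:
  fixes x :: real
  assumes "x \<noteq> 0"
  shows "(\<lambda>n. \<Prod>k=1..n. 1 + x\<^sup>2 / (real k)\<^sup>2) \<longlonglongrightarrow> sinh (pi * x) / (pi * x)"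
proof -
  define z where "z = \<i> * complex_of_real x"
  have z: "of_real pi * z \<noteq> 0" "z\<^sup>2 = - of_real (x\<^sup>2)"
    using assms by (auto simp: z_def power_mult_distrib)
  have "(\<lambda>n. (of_real pi * z * (\<Prod>k=1..n. 1 - z\<^sup>2 / of_nat k ^ 2)) / (of_real pi * z))
          \<longlonglongrightarrow> sin (of_real pi * z) / (of_real pi * z)"
    by (intro tendsto_divide sin_product_formula_complex tendsto_const z)
  hence "(\<lambda>n. \<Prod>k=1..n. 1 - z\<^sup>2 / of_nat k ^ 2) \<longlonglongrightarrow> sin (of_real pi * z) / (of_real pi * z)"
    using z(1) by simp
  also have "(\<lambda>n. \<Prod>k=1..n. 1 - z\<^sup>2 / of_nat k ^ 2) = (\<lambda>n. of_real (\<Prod>k=1..n. 1 + x\<^sup>2 / (real k)\<^sup>2))"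
    by (simp add: z(2))
  also have "sin (of_real pi * z) / (of_real pi * z) = of_real (sinh (pi * x) / (pi * x))"
  proof -
    have "sin (of_real pi * z) = \<i> * sinh (complex_of_real (pi * x))"
      by (simp add: z_def sinh_conv_sin mult_ac)
    also have "sinh (complex_of_real (pi * x)) = of_real (sinh (pi * x))"
      by (simp add: sinh_field_def exp_of_real flip: of_real_mult of_real_minus)
    finally show ?thesis by (simp add: z_def)
  qed
  finally show ?thesis by (simp only: tendsto_of_real_iff)
qed

lemma ln_sinh_product_sums:
  assumes "0 < t"
  shows "(\<lambda>k. ln (1 + 1 / (real (Suc k) * t)\<^sup>2)) sums ln (sinh (pi / t) * t / pi)"
proof -
  have "(\<lambda>n. \<Prod>k=1..n. 1 + 1 / (real k * t)\<^sup>2) \<longlonglongrightarrow> sinh (pi / t) * t / pi"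
    using sinh_product_formula[of "1 / t"] assms by (simp add: power_mult_distrib power_divide mult.commute)
  moreover have "0 < sinh (pi / t) * t / pi"
    using assms by (intro divide_pos_pos mult_pos_pos) auto
  ultimately have "(\<lambda>n. ln (\<Prod>k=1..n. 1 + 1 / (real k * t)\<^sup>2)) \<longlonglongrightarrow> ln (sinh (pi / t) * t / pi)"
    by (intro tendsto_ln) auto
  moreover have "ln (\<Prod>k=1..n. 1 + 1 / (real k * t)\<^sup>2) = (\<Sum>k<n. ln (1 + 1 / (real (Suc k) * t)\<^sup>2))" for n
  proof -
    have "ln (\<Prod>k=1..n. 1 + 1 / (real k * t)\<^sup>2) = (\<Sum>k=1..n. ln (1 + 1 / (real k * t)\<^sup>2))"
      by (rule ln_prod) (auto simp: add_nonneg_eq_0_iff add_pos_nonneg)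
    also have "\<dots> = (\<Sum>k<n. ln (1 + 1 / (real (Suc k) * t)\<^sup>2))"
      by (rule sum.reindex_bij_witness[of _ Suc "\<lambda>k. k - 1"]) auto
    finally show ?thesis .
  qed
  ultimately show ?thesis by (simp add: sums_def)
qed

text \<open>The summand \<open>- ln (1 - exp (- x))\<close> with its logarithmic singularity at 0 removed by the factors of the
  product for \<open>sinh\<close>. At \<open>x = 0\<close> the convention \<open>ln 0 = 0\<close> gives the correct limit value \<open>0\<close>.\<close>
definition regularized_ln :: "real \<Rightarrow> real" where
  "regularized_ln x = - ln (1 - exp (- x)) + ln x - ln (1 + x\<^sup>2) / 2"

definition bernoulli_kernel :: "real \<Rightarrow> real" where
  "bernoulli_kernel x = 1 / x - 1 / (exp x - 1)"

lemma regularized_ln_sums: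
  assumes "0 < t"
  shows "(\<lambda>k. regularized_ln (real (Suc k) * t)) sums (ln_partition_gf t - ln (sinh (pi / t) * t / pi) / 2)"
proof -
  have "(\<lambda>k. - ln (1 - exp (- (real (Suc k) * t))) - ln (1 + 1 / (real (Suc k) * t)\<^sup>2) / 2)
          sums (ln_partition_gf t - ln (sinh (pi / t) * t / pi) / 2)"
    by (intro sums_diff sums_divide ln_partition_gf_sums ln_sinh_product_sums assms)
  moreover have "regularized_ln x = - ln (1 - exp (- x)) - ln (1 + 1 / x\<^sup>2) / 2" if "0 < x" for x
  proof -
    have "1 + 1 / x\<^sup>2 = (1 + x\<^sup>2) / x\<^sup>2" using that by (simp add: field_simps)
    hence "ln (1 + 1 / x\<^sup>2) = ln (1 + x\<^sup>2) - 2 * ln x"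
      using that by (simp add: ln_div ln_realpow add_nonneg_eq_0_iff)
    thus ?thesis by (simp add: regularized_ln_def diff_divide_distrib)
  qed
  ultimately show ?thesis using assms by simp
qed

lemma bernoulli_kernel_bounds:
  assumes "0 < x"
  shows "0 \<le> bernoulli_kernel x" "bernoulli_kernel x \<le> 1"
proof -
  have exp_ge: "x \<le> exp x - 1" using exp_ge_add_one_self[of x] by linarith
  show "0 \<le> bernoulli_kernel x"
    unfolding bernoulli_kernel_def using assms exp_ge by (simp add: field_simps)
  have "exp x * (1 - x) \<le> exp x * exp (- x)"
    using exp_ge_add_one_self[of "-x"] by (intro mult_left_mono) auto
  also have "\<dots> = 1" by (simp add: exp_minus)
  finally show "bernoulli_kernel x \<le> 1"
    unfolding bernoulli_kernel_def using assms exp_ge by (simp add: field_simps)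
qed

lemma mult_exp_half_le:
  fixes x :: real
  assumes "0 \<le> x"
  shows "x * exp (x / 2) \<le> exp x - 1"
proof -
  have "exp 0 - 1 - 0 * exp (0 / 2) \<le> exp x - 1 - x * exp (x / 2)"
  proof (rule DERIV_nonneg_imp_nondecreasing[OF assms, of "\<lambda>x. exp x - 1 - x * exp (x / 2)"])
    fix y :: real assume "0 \<le> y"
    have "((\<lambda>x. exp x - 1 - x * exp (x / 2)) has_real_derivative
            exp y - (exp (y / 2) + y * (exp (y / 2) / 2))) (at y)"
      by (auto intro!: derivative_eq_intros)
    moreover have "exp y - (exp (y / 2) + y * (exp (y / 2) / 2)) = exp (y / 2) * (exp (y / 2) - (1 + y / 2))"
      by (simp add: algebra_simps flip: exp_add)
    moreover have "\<dots> \<ge> 0" by (intro mult_nonneg_nonneg) auto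
    ultimately show "\<exists>D. ((\<lambda>x. exp x - 1 - x * exp (x / 2)) has_real_derivative D) (at y) \<and> 0 \<le> D"
      by metis
  qed
  thus ?thesis by simp
qed

lemma bernoulli_kernel_antimono:
  assumes "0 < x" "x \<le> y"
  shows "bernoulli_kernel y \<le> bernoulli_kernel x"
proof (rule DERIV_nonpos_imp_nonincreasing[OF assms(2)])
  fix z assume "x \<le> z" "z \<le> y"
  hence z: "0 < z" "1 < exp z" using assms by auto
  have "(bernoulli_kernel has_real_derivative (exp z / (exp z - 1)\<^sup>2 - 1 / z\<^sup>2)) (at z)"
    unfolding bernoulli_kernel_def[abs_def] using z
    by (auto intro!: derivative_eq_intros simp: power2_eq_square field_simps)
  moreover have "exp z / (exp z - 1)\<^sup>2 \<le> 1 / z\<^sup>2"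
  proof -
    have "z\<^sup>2 * exp z = (z * exp (z / 2))\<^sup>2"
      by (simp add: power2_eq_square algebra_simps flip: exp_add)
    also have "\<dots> \<le> (exp z - 1)\<^sup>2" using z mult_exp_half_le[of z] by (intro power_mono) auto
    finally show ?thesis using z by (simp add: field_simps)
  qed
  ultimately show "\<exists>D. (bernoulli_kernel has_real_derivative D) (at z) \<and> D \<le> 0"
    by (intro exI[of _ "exp z / (exp z - 1)\<^sup>2 - 1 / z\<^sup>2"]) auto
qed

lemma abs_increment_le_arctan:
  assumes "x \<le> y"
  shows "\<bar>y / (1 + y\<^sup>2) - x / (1 + x\<^sup>2)\<bar> \<le> arctan y - arctan x"
proof -
  have nz: "1 + z\<^sup>2 \<noteq> 0" "1 + z * z \<noteq> 0" for z :: real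
    using sum_power2_eq_zero_iff[of 1 z] by (auto simp: power2_eq_square)
  have quotient: "((\<lambda>z. z / (1 + z\<^sup>2)) has_real_derivative ((1 - z\<^sup>2) / (1 + z\<^sup>2)\<^sup>2)) (at z)" for z :: real
    by (auto intro!: derivative_eq_intros simp: nz) (simp add: power2_eq_square field_simps nz)
  have arctan: "(arctan has_real_derivative ((1 + z\<^sup>2) / (1 + z\<^sup>2)\<^sup>2)) (at z)" for z :: real
  proof -
    have "(1 + z\<^sup>2) / (1 + z\<^sup>2)\<^sup>2 = inverse (1 + z\<^sup>2)"
      using nz(1)[of z] by (simp add: power2_eq_square[of "1 + z\<^sup>2"] inverse_eq_divide)
    thus ?thesis using DERIV_arctan[of z] by simp
  qed
  have "arctan x - x / (1 + x\<^sup>2) \<le> arctan y - y / (1 + y\<^sup>2)"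
    by (rule DERIV_nonneg_imp_nondecreasing[OF assms])
       (use DERIV_diff[OF arctan quotient] in \<open>force simp: diff_divide_distrib[symmetric]\<close>)
  moreover have "arctan x + x / (1 + x\<^sup>2) \<le> arctan y + y / (1 + y\<^sup>2)"
    by (rule DERIV_nonneg_imp_nondecreasing[OF assms])
       (use DERIV_add[OF arctan quotient] in \<open>force simp: add_divide_distrib[symmetric]\<close>)
  ultimately show ?thesis by (simp add: abs_le_iff)
qed

lemma DERIV_regularized_ln:
  assumes "0 < x"
  shows "(regularized_ln has_real_derivative (bernoulli_kernel x - x / (1 + x\<^sup>2))) (at x)"
proof -
  have pos: "1 + x\<^sup>2 > 0" "1 + x * x > 0" by (auto simp: add_pos_nonneg)
  have exp: "exp x > 1" "exp (- x) < 1" using assms by auto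
  have "(regularized_ln has_real_derivative (- (exp (- x) / (1 - exp (- x))) + 1 / x - x / (1 + x\<^sup>2))) (at x)"
    unfolding regularized_ln_def[abs_def] using assms pos exp
    by (auto intro!: derivative_eq_intros) (simp add: divide_simps; simp add: algebra_simps)
  moreover have "exp (- x) / (1 - exp (- x)) = 1 / (exp x - 1)"
    using exp by (simp add: exp_minus field_simps)
  ultimately show ?thesis by (simp add: bernoulli_kernel_def)
qed

lemma continuous_on_regularized_ln: "continuous_on {0..} regularized_ln"
  unfolding continuous_on_eq_continuous_within
proof
  fix x :: real assume "x \<in> {0..}"
  then consider (zero) "x = 0" | (pos) "0 < x" by fastforce
  thus "continuous (at x within {0..}) regularized_ln"
  proof cases
    case zero
    have "(regularized_ln \<longlongrightarrow> 0) (at_right 0)"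
      unfolding regularized_ln_def[abs_def] by real_asymp
    moreover have "at (0::real) within {0..} = at_right 0"
      by (rule at_within_nhd[of _ UNIV]) auto
    ultimately show ?thesis by (simp add: zero continuous_within regularized_ln_def)
  next
    case pos
    show ?thesis
      by (rule continuous_at_imp_continuous_at_within[OF DERIV_isCont[OF DERIV_regularized_ln[OF pos]]])
  qed
qed

interpretation regularized_ln: trapezoidal_sum regularized_ln "\<lambda>x. bernoulli_kernel x - x / (1 + x\<^sup>2)"
  "\<lambda>x. arctan x - bernoulli_kernel x" "\<lambda>t. ln_partition_gf t - ln (sinh (pi / t) * t / pi) / 2" "-1" 2
proof
  show "\<bar>bernoulli_kernel y - y / (1 + y\<^sup>2) - (bernoulli_kernel x - x / (1 + x\<^sup>2))\<bar>
      \<le> arctan y - bernoulli_kernel y - (arctan x - bernoulli_kernel x)" if "0 < x" "x \<le> y" for x y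
    using abs_increment_le_arctan[OF that(2)] bernoulli_kernel_antimono[OF that] by linarith
  show "-1 \<le> arctan x - bernoulli_kernel x" if "0 < x" for x
    using bernoulli_kernel_bounds[OF that] zero_le_arctan_iff[of x] that by linarith
  show "arctan x - bernoulli_kernel x \<le> 2" if "0 < x" for x
    using bernoulli_kernel_bounds[OF that] arctan_ubound[of x] pi_less_4 by linarith
qed (use continuous_on_regularized_ln DERIV_regularized_ln regularized_ln_sums in auto)

theorem ln_partition_gf_asymptotics:
  "((\<lambda>t. ln_partition_gf t - pi\<^sup>2 / (6 * t) - ln (t / (2 * pi)) / 2) \<longlongrightarrow> 0) (at_right 0)"
proof -
  let ?S = "\<lambda>t. ln_partition_gf t - ln (sinh (pi / t) * t / pi) / 2"
  have "((\<lambda>t. t * (ln (sinh (pi / t) * t / pi) / 2)) \<longlongrightarrow> pi / 2) (at_right 0)"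
    unfolding sinh_field_def by real_asymp
  from tendsto_diff[OF tendsto_mult_ln_partition_gf this]
  have "((\<lambda>t. t * ?S t) \<longlongrightarrow> pi\<^sup>2 / 6 - pi / 2) (at_right 0)"
    by (simp only: right_diff_distrib)
  hence "((\<lambda>t. ?S t - (pi\<^sup>2 / 6 - pi / 2) / t) \<longlongrightarrow> 0) (at_right 0)"
    using regularized_ln.tendsto_sum_minus_leading_term by (simp add: regularized_ln_def)
  moreover have "((\<lambda>t. ln (sinh (pi / t) * t / pi) / 2 - pi / (2 * t) - ln (t / (2 * pi)) / 2) \<longlongrightarrow> 0) (at_right 0)"
    unfolding sinh_field_def by real_asymp
  ultimately have "((\<lambda>t. (?S t - (pi\<^sup>2 / 6 - pi / 2) / t)
      + (ln (sinh (pi / t) * t / pi) / 2 - pi / (2 * t) - ln (t / (2 * pi)) / 2)) \<longlongrightarrow> 0 + 0) (at_right 0)"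
    by (intro tendsto_add)
  moreover have "(?S t - (pi\<^sup>2 / 6 - pi / 2) / t)
      + (ln (sinh (pi / t) * t / pi) / 2 - pi / (2 * t) - ln (t / (2 * pi)) / 2)
      = ln_partition_gf t - pi\<^sup>2 / (6 * t) - ln (t / (2 * pi)) / 2" for t
    by (simp add: diff_divide_distrib)
  ultimately show ?thesis by simp
qed

section \<open>The saddle point method for nonnegative power series\<close>

theorem Vitali_convergence:
  fixes f :: "nat \<Rightarrow> complex \<Rightarrow> complex"
  assumes S: "open S" "connected S"
    and hol: "\<And>n. f n holomorphic_on S" "g holomorphic_on S"
    and bound: "\<And>K. compact K \<Longrightarrow> K \<subseteq> S \<Longrightarrow> \<exists>B. \<forall>n. \<forall>z\<in>K. norm (f n z) \<le> B"
    and U: "U \<subseteq> S" "\<xi> \<in> S" "\<xi> islimpt U"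
    and lim: "\<And>z. z \<in> U \<Longrightarrow> (\<lambda>n. f n z) \<longlonglongrightarrow> g z"
    and w: "w \<in> S"
  shows "(\<lambda>n. f n w) \<longlonglongrightarrow> g w"
proof (rule ccontr)
  assume "\<not> (\<lambda>n. f n w) \<longlonglongrightarrow> g w"
  then obtain e where e: "e > 0" "\<not> eventually (\<lambda>n. dist (f n w) (g w) < e) sequentially"
    unfolding tendsto_iff by blast
  hence "infinite {n. \<not> dist (f n w) (g w) < e}"
    by (simp add: INFM_iff_infinite[symmetric] not_eventually cofinite_eq_sequentially)
  then obtain r :: "nat \<Rightarrow> nat" where r: "strict_mono r" "\<And>n. \<not> dist (f (r n) w) (g w) < e"
    using infinite_enumerate by blast
  obtain h q where h: "h holomorphic_on S" "strict_mono q"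
    "\<And>z. z \<in> S \<Longrightarrow> (\<lambda>n. (f \<circ> r) (q n) z) \<longlonglongrightarrow> h z"
  proof (rule Montel[OF S(1), of "range (f \<circ> r)" "f \<circ> r"])
    show "\<And>h. h \<in> range (f \<circ> r) \<Longrightarrow> h holomorphic_on S" using hol by auto
    show "\<exists>B. \<forall>h\<in>range (f \<circ> r). \<forall>z\<in>K. norm (h z) \<le> B" if "compact K" "K \<subseteq> S" for K
      using bound[OF that] by fastforce
  qed (use that in auto)
  have "h z - g z = 0" if "z \<in> U" for z
  proof -
    have "(\<lambda>n. f (r (q n)) z) \<longlonglongrightarrow> g z"
      using LIMSEQ_subseq_LIMSEQ[OF lim[OF that] strict_mono_o[OF r(1) h(2)]] by (simp add: o_def)
    moreover have "(\<lambda>n. f (r (q n)) z) \<longlonglongrightarrow> h z" using h(3) that U by auto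
    ultimately show ?thesis using LIMSEQ_unique by auto
  qed
  hence "h w - g w = 0"
    by (intro analytic_continuation[of "\<lambda>z. h z - g z" S U \<xi> w] holomorphic_intros h hol S U w)
  hence "(\<lambda>n. f (r (q n)) w) \<longlonglongrightarrow> g w" using h(3)[OF w] by simp
  hence "eventually (\<lambda>n. dist (f (r (q n)) w) (g w) < e) sequentially" using e by (simp add: tendsto_iff)
  thus False using r(2) by (auto simp: eventually_sequentially)
qed

lemma open_connected_vertical_strip: "open {w. \<bar>Re w\<bar> < 1}" "connected {w. \<bar>Re w\<bar> < 1}"
proof -
  have strip: "{w. \<bar>Re w\<bar> < 1} = {w. Re w < 1} \<inter> {w. - 1 < Re w}" by auto
  show "open {w. \<bar>Re w\<bar> < 1}"
    unfolding strip by (intro open_Int open_halfspace_Re_lt open_halfspace_Re_gt)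
  show "connected {w. \<bar>Re w\<bar> < 1}"
    unfolding strip by (intro convex_connected convex_Int convex_halfspace_Re_lt convex_halfspace_Re_gt)
qed

lemma zero_islimpt_real_interval: "(0 :: complex) islimpt of_real ` {-1<..<1}"
  unfolding islimpt_approachable
proof (intro allI impI)
  fix e :: real assume "0 < e"
  thus "\<exists>z\<in>complex_of_real ` {-1<..<1}. z \<noteq> 0 \<and> dist z 0 < e"
    by (intro bexI[of _ "of_real (min (e / 2) (1 / 2))"]) (auto simp: min_def)
qed

lemma integral_cis_full_period:
  fixes m :: int
  shows "set_integrable lborel {-pi..pi} (\<lambda>\<theta>. cis (of_int m * \<theta>))"
    and "(LBINT \<theta>:{-pi..pi}. cis (of_int m * \<theta>)) = (if m = 0 then 2 * pi else 0)"
proof -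
  have cont: "continuous_on {-pi..pi} (\<lambda>\<theta>. cis (of_int m * \<theta>))"
    by (intro continuous_intros)
  show "set_integrable lborel {-pi..pi} (\<lambda>\<theta>. cis (of_int m * \<theta>))"
    by (rule borel_integrable_atLeastAtMost'[OF cont])
  show "(LBINT \<theta>:{-pi..pi}. cis (of_int m * \<theta>)) = (if m = 0 then 2 * pi else 0)"
  proof (cases "m = 0")
    case False
    have "(LBINT \<theta>:{-pi..pi}. cis (of_int m * \<theta>))
        = cis (of_int m * pi) / (\<i> * of_int m) - cis (of_int m * (- pi)) / (\<i> * of_int m)"
      unfolding set_lebesgue_integral_def
    proof (rule integral_FTC_atLeastAtMost[OF _ _ cont])
      fix \<theta> :: real
      have "((\<lambda>\<theta>. exp (\<i> * of_real (of_int m * \<theta>)) / (\<i> * of_int m)) has_vector_derivative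
              exp (\<i> * of_real (of_int m * \<theta>))) (at \<theta> within {- pi..pi})"
        using False by (auto intro!: derivative_eq_intros has_vector_derivative_real_field)
          (simp add: mult.commute[of "exp _" \<i>])
      thus "((\<lambda>\<theta>. cis (of_int m * \<theta>) / (\<i> * of_int m)) has_vector_derivative cis (of_int m * \<theta>))
              (at \<theta> within {- pi..pi})"
        by (simp add: cis_conv_exp)
    qed auto
    also have "cis (of_int m * (- pi)) = cis (of_int m * pi)"
      by (simp add: complex_eq_iff sin_times_pi_eq_0)
    finally show ?thesis using False by simp
  qed (simp add: scaleR_conv_of_real set_lebesgue_integral_def)
qed

lemma integral_gaussian:
  assumes "0 < A"
  shows "integrable lborel (\<lambda>x. exp (- A * x\<^sup>2))" "(\<integral>x. exp (- A * x\<^sup>2) \<partial>lborel) = sqrt (pi / A)"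
proof -
  define \<sigma> where "\<sigma> = sqrt (1 / (2 * A))"
  have \<sigma>: "0 < \<sigma>" "\<sigma>\<^sup>2 = 1 / (2 * A)" using assms by (auto simp: \<sigma>_def)
  have density: "exp (- A * x\<^sup>2) = sqrt (pi / A) * normal_density 0 \<sigma> x" for x
  proof -
    have "sqrt (2 * pi * \<sigma>\<^sup>2) = sqrt (pi / A)" by (simp add: \<sigma>)
    moreover have "- (x - 0)\<^sup>2 / (2 * \<sigma>\<^sup>2) = - A * x\<^sup>2" using assms by (simp add: \<sigma>)
    ultimately show ?thesis using assms unfolding normal_density_def by simp
  qed
  show "integrable lborel (\<lambda>x. exp (- A * x\<^sup>2))" "(\<integral>x. exp (- A * x\<^sup>2) \<partial>lborel) = sqrt (pi / A)"
    unfolding density using \<sigma>(1) by simp_all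
qed

lemma exp_mult_le_exp_plus_exp:
  fixes c x d :: real
  assumes "\<bar>x\<bar> \<le> d"
  shows "exp (c * x) \<le> exp (c * d) + exp (c * - d)"
proof -
  have "c * x \<le> \<bar>c\<bar> * \<bar>x\<bar>" by (simp flip: abs_mult)
  also have "\<dots> \<le> \<bar>c\<bar> * d" using assms by (intro mult_left_mono) auto
  finally have "c * x \<le> \<bar>c\<bar> * d" .
  hence "exp (c * x) \<le> exp (\<bar>c\<bar> * d)" by simp
  also have "\<dots> \<le> exp (c * d) + exp (c * - d)" by (cases "c \<ge> 0") auto
  finally show ?thesis .
qed

locale nonneg_power_series =
  fixes s :: "nat \<Rightarrow> real"
  assumes nonneg: "0 \<le> s n"
    and summable_power: "0 \<le> r \<Longrightarrow> r < 1 \<Longrightarrow> summable (\<lambda>n. s n * r ^ n)"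
begin

definition gf :: "'a \<Rightarrow> 'a :: {real_normed_field, banach}" where
  "gf z = (\<Sum>n. of_real (s n) * z ^ n)"

lemma summable_norm_gf:
  fixes z :: "'a :: {real_normed_field, banach}"
  shows "norm z < 1 \<Longrightarrow> summable (\<lambda>n. norm (of_real (s n) * z ^ n))"
  using summable_power[of "norm z"] nonneg by (simp add: norm_mult norm_power)

lemma gf_sums:
  fixes z :: "'a :: {real_normed_field, banach}"
  shows "norm z < 1 \<Longrightarrow> (\<lambda>n. of_real (s n) * z ^ n) sums gf z"
  unfolding gf_def by (rule summable_sums[OF summable_norm_cancel[OF summable_norm_gf]])

lemma gf_of_real: "\<bar>r\<bar> < 1 \<Longrightarrow> gf (of_real r) = complex_of_real (gf r)"
  using sums_of_real[OF gf_sums[of r], where ?'a = complex] gf_sums[of "complex_of_real r"]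
  by (simp add: sums_iff)

lemma gf_nonneg: "0 \<le> r \<Longrightarrow> r < 1 \<Longrightarrow> 0 \<le> gf r" for r :: real
  using sums_le[OF _ sums_zero gf_sums[of r]] nonneg by simp

lemma holomorphic_gf: "gf holomorphic_on ball 0 1"
  by (rule power_series_holomorphic[where a = "\<lambda>n. of_real (s n)"]) (use gf_sums in auto)

definition weight :: "real \<Rightarrow> nat \<Rightarrow> real" where
  "weight t k = s k * exp (- t) ^ k / gf (exp (- t))"

lemma weight_nonneg: "0 < t \<Longrightarrow> 0 \<le> weight t k"
  unfolding weight_def using nonneg gf_nonneg[of "exp (- t)"] by simp

lemma summable_weight: "0 < t \<Longrightarrow> summable (weight t)"
  unfolding weight_def[abs_def] by (intro summable_divide summable_power) auto

text \<open>The moment generating function of \<open>k - \<nu>\<close> when \<open>k\<close> has the distribution \<open>weight t\<close>.\<close>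
definition tilt :: "real \<Rightarrow> real \<Rightarrow> 'a \<Rightarrow> 'a :: {real_normed_field, banach}" where
  "tilt t \<nu> z = gf (exp (z - of_real t)) / of_real (gf (exp (- t))) * exp (- (of_real \<nu> * z))"

lemma tilt_sums:
  fixes z :: "'a :: {real_normed_field, banach}"
  assumes "norm (exp (z - of_real t)) < 1"
  shows "(\<lambda>k. of_real (weight t k) * exp (of_real (real k - \<nu>) * z)) sums tilt t \<nu> z"
proof -
  have "(\<lambda>k. of_real (s k) * exp (z - of_real t) ^ k / of_real (gf (exp (- t))) * exp (- (of_real \<nu> * z)))
      sums tilt t \<nu> z"
    unfolding tilt_def by (intro sums_mult2 sums_divide gf_sums assms)
  moreover have "exp (z - of_real t) ^ k * exp (- (of_real \<nu> * z))
      = of_real (exp (- t) ^ k) * exp (of_real (real k - \<nu>) * z)" for k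
  proof -
    have "exp (z - of_real t) ^ k * exp (- (of_real \<nu> * z))
        = exp (of_nat k * (z - of_real t) + - (of_real \<nu> * z))"
      unfolding exp_of_nat_mult[symmetric] exp_add[symmetric] ..
    also have "\<dots> = exp (of_real (real k * - t) + of_real (real k - \<nu>) * z)"
      by (simp add: algebra_simps)
    also have "\<dots> = of_real (exp (- t) ^ k) * exp (of_real (real k - \<nu>) * z)"
      by (simp only: exp_add exp_of_real exp_of_nat_mult)
    finally show ?thesis .
  qed
  ultimately show ?thesis by (simp add: weight_def mult_ac)
qed

lemma tilt_of_real:
  assumes "x < t" "0 < t"
  shows "tilt t \<nu> (of_real x) = complex_of_real (tilt t \<nu> x)"
proof -
  have "complex_of_real (gf (exp (x - t))) = gf (of_real (exp (x - t)))"
    using assms by (intro gf_of_real[symmetric]) simp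
  also have "\<dots> = gf (exp (of_real x - of_real t))" by (simp flip: exp_of_real)
  finally have gf_eq: "gf (exp (of_real x - of_real t)) = complex_of_real (gf (exp (x - t)))" ..
  show ?thesis
    unfolding tilt_def gf_eq by (simp add: exp_of_real flip: of_real_mult of_real_minus)
qed

lemma norm_tilt_le:
  assumes "Re z < t" "0 < t"
  shows "norm (tilt t \<nu> z) \<le> tilt t \<nu> (Re z)"
proof (rule norm_sums_le)
  show "(\<lambda>k. of_real (weight t k) * exp (of_real (real k - \<nu>) * z)) sums tilt t \<nu> z"
    using assms by (intro tilt_sums) simp
  show "(\<lambda>k. weight t k * exp ((real k - \<nu>) * Re z)) sums tilt t \<nu> (Re z)"
    using tilt_sums[of "Re z" t \<nu>] assms by simp
  show "norm (of_real (weight t k) * exp (of_real (real k - \<nu>) * z))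
      \<le> weight t k * exp ((real k - \<nu>) * Re z)" for k
    using weight_nonneg[OF assms(2)] by (simp add: norm_mult)
qed

lemma tilt_le:
  fixes x d :: real
  assumes "\<bar>x\<bar> \<le> d" "d < t"
  shows "tilt t \<nu> x \<le> tilt t \<nu> d + tilt t \<nu> (- d)"
proof (rule sums_le)
  have sums: "(\<lambda>k. weight t k * exp ((real k - \<nu>) * y)) sums tilt t \<nu> y" if "y < t" for y
    using tilt_sums[of y t \<nu>] that by simp
  show "(\<lambda>k. weight t k * exp ((real k - \<nu>) * x)) sums tilt t \<nu> x"
    using assms by (intro sums) auto
  show "(\<lambda>k. weight t k * exp ((real k - \<nu>) * d) + weight t k * exp ((real k - \<nu>) * - d))
      sums (tilt t \<nu> d + tilt t \<nu> (- d))"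
    using assms by (intro sums_add sums) auto
  show "weight t k * exp ((real k - \<nu>) * x)
      \<le> weight t k * exp ((real k - \<nu>) * d) + weight t k * exp ((real k - \<nu>) * - d)" for k
    using mult_left_mono[OF exp_mult_le_exp_plus_exp[OF assms(1), of "real k - \<nu>"] weight_nonneg[of t k]] assms
    by (simp add: distrib_left)
qed

lemma coefficient_eq_integral_tilt:
  assumes "0 < t"
  shows "(LBINT \<theta>:{-pi..pi}. tilt t (real n) (\<i> * of_real \<theta>)) = of_real (2 * pi * weight t n)"
proof -
  define f where "f k \<theta> = of_real (weight t k) * (indicator {-pi..pi} \<theta> *\<^sub>R cis (of_int (int k - int n) * \<theta>))"
    for k \<theta>
  have norm_f: "norm (f k \<theta>) = indicator {-pi..pi} \<theta> * weight t k" for k \<theta>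
    using weight_nonneg[OF assms] by (simp add: f_def norm_mult split: split_indicator)
  have "(\<lambda>k. integral\<^sup>L lborel (f k)) sums (\<integral>\<theta>. (\<Sum>k. f k \<theta>) \<partial>lborel)"
  proof (rule sums_integral)
    show "integrable lborel (f k)" for k
      unfolding f_def[abs_def]
      by (intro integrable_mult_right integral_cis_full_period(1)[unfolded set_integrable_def])
    show "AE \<theta> in lborel. summable (\<lambda>k. norm (f k \<theta>))"
      unfolding norm_f using summable_weight[OF assms] by (intro AE_I2 summable_mult)
    show "summable (\<lambda>k. \<integral>\<theta>. norm (f k \<theta>) \<partial>lborel)"
      unfolding norm_f using summable_weight[OF assms] by simp
  qed
  moreover have "integral\<^sup>L lborel (f k) = (if k = n then of_real (2 * pi * weight t n) else 0)" for k
    unfolding f_def[abs_def] integral_mult_right_zero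
    using integral_cis_full_period(2)[of "int k - int n"] by (simp add: set_lebesgue_integral_def)
  moreover have "(\<Sum>k. f k \<theta>) = indicator {-pi..pi} \<theta> *\<^sub>R tilt t (real n) (\<i> * of_real \<theta>)" for \<theta>
  proof (rule sums_unique[symmetric])
    have "(\<lambda>k. indicator {-pi..pi} \<theta> *\<^sub>R
          (of_real (weight t k) * exp (of_real (real k - real n) * (\<i> * of_real \<theta>))))
        sums (indicator {-pi..pi} \<theta> *\<^sub>R tilt t (real n) (\<i> * of_real \<theta>))"
      using assms by (intro sums_scaleR_right tilt_sums) simp
    thus "(\<lambda>k. f k \<theta>) sums (indicator {-pi..pi} \<theta> *\<^sub>R tilt t (real n) (\<i> * of_real \<theta>))"
      by (simp add: f_def cis_conv_exp mult_ac)
  qed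
  ultimately have "(\<lambda>k. if k = n then complex_of_real (2 * pi * weight t n) else 0)
      sums (LBINT \<theta>:{-pi..pi}. tilt t (real n) (\<i> * of_real \<theta>))"
    by (simp only: set_lebesgue_integral_def)
  from sums_unique2[OF this sums_single] show ?thesis .
qed

end

definition saddle_decay :: "real \<Rightarrow> real \<Rightarrow> real" where
  "saddle_decay t \<theta> = 1 / (1 + \<theta>\<^sup>2 / t ^ 3)"

text \<open>Ingham's Tauberian theorem, with the monotonicity of the coefficients replaced by a bound on the generating
  function off the real axis.\<close>

locale saddle_point = nonneg_power_series +
  fixes A \<beta> K C :: real
  assumes A_pos: "0 < A" and K_pos: "0 < K"
    and gf_asymp: "(\<lambda>t. gf (exp (- t))) \<sim>[at_right 0] (\<lambda>t. K * t powr \<beta> * exp (A / t))"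
    and gf_decay: "\<forall>\<^sub>F t in at_right 0. \<forall>\<theta>\<in>{-pi..pi}.
           norm (gf (rcis (exp (- t)) \<theta>)) \<le> C * gf (exp (- t)) * saddle_decay t \<theta>"
begin

lemma eventually_gf_pos: "\<forall>\<^sub>F t :: real in at_right 0. 0 < gf (exp (- t))"
proof -
  have "\<forall>\<^sub>F t in at_right 0. 0 < K * t powr \<beta> * exp (A / t)"
    using eventually_at_right_less[of 0] by eventually_elim (use K_pos in simp)
  with asymp_equiv_eventually_pos_iff[OF gf_asymp] show ?thesis
    by eventually_elim simp
qed

lemma C_nonneg: "0 \<le> C"
proof -
  have "\<forall>\<^sub>F t :: real in at_right 0. 0 \<le> C"
    using gf_decay eventually_gf_pos eventually_at_right_less[of 0]
  proof eventually_elim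
    case (elim t)
    have "0 \<le> C * gf (exp (- t)) * saddle_decay t 0"
      using bspec[OF elim(1), of 0] order_trans[OF norm_ge_zero] by simp
    thus ?case using elim by (simp add: saddle_decay_def zero_le_mult_iff)
  qed
  thus ?thesis by simp
qed

text \<open>At \<open>t = sqrt (A / n)\<close> the standard deviation of the tilted law is of order \<open>t powr (- 3/2)\<close>; in this scale it
  is asymptotically normal. Its moment generating function is bounded in a vertical strip by its values on the real
  axis, so Vitali's theorem transfers the limit to the imaginary axis, without any expansion of the generating
  function at complex arguments.\<close>

definition saddle_tilt :: "real \<Rightarrow> 'a \<Rightarrow> 'a :: {real_normed_field, banach}" where
  "saddle_tilt t w = tilt t (A / t\<^sup>2) (of_real (t * sqrt t) * w)"

lemma saddle_exponent:
  fixes t x :: real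
  assumes "0 < t" "sqrt t * x < 1"
  shows "A / (t * (1 - sqrt t * x)) - A / t - A / t * (sqrt t * x) = A * x\<^sup>2 / (1 - sqrt t * x)"
proof -
  define y where "y = 1 - sqrt t * x"
  have y: "0 < y" "sqrt t * x = 1 - y" using assms by (auto simp: y_def)
  have "A / (t * y) - A / t - A / t * (1 - y) = A * (1 - y)\<^sup>2 / (t * y)"
    using y assms by (simp add: field_simps power2_eq_square)
  also have "(1 - y)\<^sup>2 = t * x\<^sup>2" using assms by (simp flip: y(2) add: power_mult_distrib)
  finally show ?thesis using assms by (simp add: y(2) flip: y_def)
qed

lemma tendsto_saddle_tilt_real:
  fixes x :: real
  shows "((\<lambda>t. saddle_tilt t x) \<longlongrightarrow> exp (A * x\<^sup>2)) (at_right 0)"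
proof -
  define y where "y t = 1 - sqrt t * x" for t
  define G where "G t = gf (exp (- t))" for t :: real
  define M where "M t = K * t powr \<beta> * exp (A / t)" for t
  have y_lim: "(y \<longlongrightarrow> 1) (at_right 0)" and y_pos: "\<forall>\<^sub>F t in at_right 0. 0 < y t"
    unfolding y_def[abs_def] by real_asymp+
  have "filterlim (\<lambda>t. t * y t) (at_right 0) (at_right 0)"
    unfolding y_def by real_asymp
  hence "(\<lambda>t. G (t * y t)) \<sim>[at_right 0] (\<lambda>t. M (t * y t))"
    unfolding G_def M_def by (rule asymp_equiv_compose'[OF gf_asymp])
  hence "(\<lambda>t. G (t * y t) / G t * exp (- (A / t * (sqrt t * x))))
      \<sim>[at_right 0] (\<lambda>t. M (t * y t) / M t * exp (- (A / t * (sqrt t * x))))"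
    unfolding G_def M_def by (intro asymp_equiv_intros gf_asymp)
  moreover have "((\<lambda>t. M (t * y t) / M t * exp (- (A / t * (sqrt t * x)))) \<longlongrightarrow> exp (A * x\<^sup>2)) (at_right 0)"
  proof (rule Lim_transform_eventually)
    have "((\<lambda>t. y t powr \<beta> * exp (A * x\<^sup>2 / y t)) \<longlongrightarrow> 1 powr \<beta> * exp (A * x\<^sup>2 / 1)) (at_right 0)"
      by (intro tendsto_intros y_lim) auto
    thus "((\<lambda>t. y t powr \<beta> * exp (A * x\<^sup>2 / y t)) \<longlongrightarrow> exp (A * x\<^sup>2)) (at_right 0)" by simp
    show "\<forall>\<^sub>F t in at_right 0. y t powr \<beta> * exp (A * x\<^sup>2 / y t)
        = M (t * y t) / M t * exp (- (A / t * (sqrt t * x)))"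
      using y_pos eventually_at_right_less[of 0]
    proof eventually_elim
      case (elim t)
      have "A * x\<^sup>2 / y t = A / (t * y t) - A / t - A / t * (sqrt t * x)"
        using elim by (simp only: y_def diff_gt_0_iff_gt saddle_exponent)
      hence "exp (A * x\<^sup>2 / y t) = exp (A / (t * y t)) / exp (A / t) * exp (- (A / t * (sqrt t * x)))"
        by (simp only: exp_diff exp_minus divide_inverse)
      thus ?case using elim K_pos by (simp add: M_def powr_mult)
    qed
  qed
  ultimately have "((\<lambda>t. G (t * y t) / G t * exp (- (A / t * (sqrt t * x)))) \<longlongrightarrow> exp (A * x\<^sup>2)) (at_right 0)"
    using tendsto_asymp_equiv_cong by blast
  moreover have "\<forall>\<^sub>F t in at_right 0. G (t * y t) / G t * exp (- (A / t * (sqrt t * x))) = saddle_tilt t x"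
    using eventually_at_right_less[of 0]
    by eventually_elim (simp add: G_def y_def saddle_tilt_def tilt_def power2_eq_square algebra_simps)
  ultimately show ?thesis by (rule Lim_transform_eventually)
qed

lemma eventually_step_less: "\<forall>\<^sub>F t in at_right 0. 0 < t \<and> t * sqrt t < (t :: real)"
proof -
  have "\<forall>\<^sub>F t in at_right 0. (t :: real) < 1" by real_asymp
  with eventually_at_right_less[of 0] show ?thesis by eventually_elim simp
qed

lemma Re_step_less:
  assumes "0 < t" "t * sqrt t < t" "\<bar>Re w\<bar> \<le> 1"
  shows "Re (of_real (t * sqrt t) * w) < t"
proof -
  have "Re (of_real (t * sqrt t) * w) = t * sqrt t * Re w" by simp
  also have "\<dots> \<le> t * sqrt t * 1" using assms by (intro mult_left_mono) auto
  finally show ?thesis using assms(2) by (simp only: mult_1_right)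
qed

lemma saddle_tilt_of_real:
  assumes "0 < t" "t * sqrt t < t" "\<bar>x\<bar> \<le> 1"
  shows "saddle_tilt t (of_real x) = complex_of_real (saddle_tilt t x)"
  using tilt_of_real[of "t * sqrt t * x" t] Re_step_less[of t "of_real x"] assms
  by (simp add: saddle_tilt_def)

lemma saddle_tilt_bounded:
  obtains B where "\<forall>\<^sub>F t in at_right 0. \<forall>w. \<bar>Re w\<bar> \<le> 1 \<longrightarrow> norm (saddle_tilt t w) \<le> B"
proof
  have "((\<lambda>t. saddle_tilt t 1 + saddle_tilt t (- 1)) \<longlongrightarrow> exp (A * 1\<^sup>2) + exp (A * (- 1)\<^sup>2)) (at_right 0)"
    by (intro tendsto_add tendsto_saddle_tilt_real)
  from order_tendstoD(2)[OF this, of "2 * exp A + 1"]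
  have "\<forall>\<^sub>F t in at_right 0. saddle_tilt t 1 + saddle_tilt t (- 1) < 2 * exp A + 1" by simp
  with eventually_step_less
  show "\<forall>\<^sub>F t in at_right 0. \<forall>w. \<bar>Re w\<bar> \<le> 1 \<longrightarrow> norm (saddle_tilt t w) \<le> 2 * exp A + 1"
  proof (eventually_elim, intro allI impI)
    fix t and w :: complex
    assume t: "0 < t \<and> t * sqrt t < t" and small: "saddle_tilt t 1 + saddle_tilt t (- 1) < 2 * exp A + 1"
      and w: "\<bar>Re w\<bar> \<le> 1"
    have "norm (saddle_tilt t w) \<le> saddle_tilt t (Re w)"
      using norm_tilt_le[OF Re_step_less[of t w]] t w by (simp add: saddle_tilt_def)
    also have "\<dots> \<le> saddle_tilt t 1 + saddle_tilt t (- 1)"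
      using tilt_le[of "t * sqrt t * Re w" "t * sqrt t" t] t w mult_left_le[of "\<bar>Re w\<bar>" "t * sqrt t"]
      by (simp add: saddle_tilt_def abs_mult)
    finally show "norm (saddle_tilt t w) \<le> 2 * exp A + 1" using small by simp
  qed
qed

lemma holomorphic_saddle_tilt:
  assumes "0 < t" "t * sqrt t < t"
  shows "saddle_tilt t holomorphic_on {w. \<bar>Re w\<bar> < 1}"
proof -
  have "(\<lambda>w. exp (of_real (t * sqrt t) * w - of_real t)) ` {w. \<bar>Re w\<bar> < 1} \<subseteq> ball 0 1"
    using Re_step_less[OF assms] by (auto simp: image_subset_iff)
  hence "(\<lambda>w. gf (exp (of_real (t * sqrt t) * w - of_real t))) holomorphic_on {w. \<bar>Re w\<bar> < 1}"
    by (intro holomorphic_on_compose_gen[OF _ holomorphic_gf, unfolded o_def] holomorphic_intros)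
  thus ?thesis
    unfolding saddle_tilt_def[abs_def] tilt_def divide_inverse
    by (intro holomorphic_on_mult[OF holomorphic_on_mult[OF _ holomorphic_on_const]] holomorphic_intros)
qed

lemma tendsto_saddle_tilt:
  assumes "\<bar>Re w\<bar> < 1"
  shows "((\<lambda>t. saddle_tilt t w) \<longlongrightarrow> exp (of_real A * w\<^sup>2)) (at_right 0)"
  unfolding tendsto_at_iff_sequentially
proof (intro allI impI)
  fix X :: "nat \<Rightarrow> real"
  assume "\<forall>i. X i \<in> {0<..} - {0}" and "X \<longlonglongrightarrow> 0"
  hence X: "filterlim X (at_right 0) sequentially"
    by (auto simp: filterlim_at intro!: always_eventually) (metis less_irrefl)
  obtain B where "\<forall>\<^sub>F t in at_right 0. \<forall>w. \<bar>Re w\<bar> \<le> 1 \<longrightarrow> norm (saddle_tilt t w) \<le> B"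
    by (rule saddle_tilt_bounded)
  hence "\<forall>\<^sub>F n in sequentially. (0 < X n \<and> X n * sqrt (X n) < X n) \<and>
      (\<forall>w. \<bar>Re w\<bar> \<le> 1 \<longrightarrow> norm (saddle_tilt (X n) w) \<le> B)"
    by (rule eventually_compose_filterlim[OF eventually_conj[OF eventually_step_less] X])
  then obtain N where N: "\<And>n. 0 < X (n + N)" "\<And>n. X (n + N) * sqrt (X (n + N)) < X (n + N)"
      "\<And>n w. \<bar>Re w\<bar> \<le> 1 \<Longrightarrow> norm (saddle_tilt (X (n + N)) w) \<le> B"
    unfolding eventually_sequentially by (meson le_add2)
  let ?S = "{w. \<bar>Re w\<bar> < 1}"
  have "(\<lambda>n. saddle_tilt (X (n + N)) w) \<longlonglongrightarrow> exp (of_real A * w\<^sup>2)"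
  proof (rule Vitali_convergence[where f = "\<lambda>n. saddle_tilt (X (n + N))" and g = "\<lambda>w. exp (of_real A * w\<^sup>2)"])
    show "open ?S" "connected ?S" by (rule open_connected_vertical_strip)+
    show "saddle_tilt (X (n + N)) holomorphic_on ?S" for n
      by (rule holomorphic_saddle_tilt[OF N(1,2)])
    show "\<exists>B. \<forall>n. \<forall>z\<in>L. norm (saddle_tilt (X (n + N)) z) \<le> B" if "L \<subseteq> ?S" for L
      using N(3) that by (intro exI[of _ B]) auto
    show "(\<lambda>n. saddle_tilt (X (n + N)) z) \<longlonglongrightarrow> exp (of_real A * z\<^sup>2)" if "z \<in> complex_of_real ` {-1<..<1}" for z
    proof -
      from that obtain x where x: "z = of_real x" "\<bar>x\<bar> < 1" by auto
      have "(\<lambda>n. complex_of_real (saddle_tilt (X (n + N)) x)) \<longlonglongrightarrow> of_real (exp (A * x\<^sup>2))"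
        by (intro tendsto_of_real LIMSEQ_ignore_initial_segment filterlim_compose[OF tendsto_saddle_tilt_real X])
      moreover have "saddle_tilt (X (n + N)) z = of_real (saddle_tilt (X (n + N)) x)" for n
        unfolding x(1) using x(2) by (intro saddle_tilt_of_real N) auto
      ultimately show ?thesis by (simp add: x(1) flip: exp_of_real)
    qed
    show "0 islimpt complex_of_real ` {-1<..<1}" by (rule zero_islimpt_real_interval)
  qed (use assms in \<open>auto intro!: holomorphic_intros\<close>)
  hence "(\<lambda>n. saddle_tilt (X n) w) \<longlonglongrightarrow> exp (of_real A * w\<^sup>2)" by (rule LIMSEQ_offset)
  thus "((\<lambda>t. saddle_tilt t w) \<circ> X) \<longlonglongrightarrow> exp (of_real A * w\<^sup>2)" by (simp add: o_def)
qed

lemma norm_saddle_tilt_imaginary_le: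
  "\<forall>\<^sub>F t in at_right 0. \<forall>u. \<bar>u\<bar> \<le> pi / (t * sqrt t) \<longrightarrow> norm (saddle_tilt t (\<i> * of_real u)) \<le> C / (1 + u\<^sup>2)"
  using gf_decay eventually_gf_pos eventually_at_right_less[of 0]
proof (eventually_elim, intro allI impI)
  fix t u :: real
  assume decay: "\<forall>\<theta>\<in>{-pi..pi}. norm (gf (rcis (exp (- t)) \<theta>)) \<le> C * gf (exp (- t)) * saddle_decay t \<theta>"
    and pos: "0 < gf (exp (- t))" "0 < t" and u: "\<bar>u\<bar> \<le> pi / (t * sqrt t)"
  define \<theta> where "\<theta> = t * sqrt t * u"
  have "\<bar>\<theta>\<bar> \<le> pi" using u pos by (simp add: \<theta>_def abs_mult field_simps)
  hence "norm (gf (rcis (exp (- t)) \<theta>)) \<le> C * gf (exp (- t)) * saddle_decay t \<theta>"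
    using decay by (simp add: abs_le_iff)
  moreover have "exp (\<i> * of_real \<theta> - of_real t) = rcis (exp (- t)) \<theta>"
    by (simp add: rcis_def cis_conv_exp exp_diff exp_minus exp_of_real field_simps)
  ultimately have "norm (saddle_tilt t (\<i> * of_real u)) \<le> C * saddle_decay t \<theta>"
    using pos by (simp add: saddle_tilt_def tilt_def \<theta>_def norm_mult norm_divide mult_ac pos_divide_le_eq)
  also have "\<theta>\<^sup>2 = t ^ 3 * u\<^sup>2"
    using pos by (simp add: \<theta>_def power_mult_distrib power2_eq_square power3_eq_cube)
  hence "saddle_decay t \<theta> = 1 / (1 + u\<^sup>2)" using pos by (simp add: saddle_decay_def)
  finally show "norm (saddle_tilt t (\<i> * of_real u)) \<le> C / (1 + u\<^sup>2)" by simp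
qed

definition saddle_integrand :: "real \<Rightarrow> real \<Rightarrow> complex" where
  "saddle_integrand t u = indicator {-(pi / (t * sqrt t))..pi / (t * sqrt t)} u *\<^sub>R saddle_tilt t (\<i> * of_real u)"

lemma tendsto_saddle_integrand:
  "((\<lambda>t. saddle_integrand t u) \<longlongrightarrow> of_real (exp (- A * u\<^sup>2))) (at_right 0)"
proof -
  have "((\<lambda>t. saddle_tilt t (\<i> * of_real u)) \<longlongrightarrow> exp (of_real A * (\<i> * of_real u)\<^sup>2)) (at_right 0)"
    by (rule tendsto_saddle_tilt) simp
  also have "exp (of_real A * (\<i> * of_real u)\<^sup>2) = complex_of_real (exp (- A * u\<^sup>2))"
    by (simp add: power_mult_distrib flip: exp_of_real)
  finally show ?thesis
  proof (rule Lim_transform_eventually)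
    have "\<forall>\<^sub>F t in at_right 0. \<bar>u\<bar> \<le> pi / (t * sqrt t)" by real_asymp
    thus "\<forall>\<^sub>F t in at_right 0. saddle_tilt t (\<i> * of_real u) = saddle_integrand t u"
      by eventually_elim (auto simp: saddle_integrand_def abs_le_iff)
  qed
qed

lemma norm_saddle_integrand_le:
  "\<forall>\<^sub>F t in at_right 0. \<forall>u. norm (saddle_integrand t u) \<le> C / (1 + u\<^sup>2)"
  using norm_saddle_tilt_imaginary_le
  by eventually_elim (use C_nonneg in \<open>auto simp: saddle_integrand_def abs_le_iff indicator_def\<close>)

lemma tendsto_integral_saddle_integrand:
  "((\<lambda>t. \<integral>u. saddle_integrand t u \<partial>lborel) \<longlongrightarrow> of_real (sqrt (pi / A))) (at_right 0)"
proof -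
  have "((\<lambda>t. \<integral>u. saddle_integrand (inverse t) u \<partial>lborel)
      \<longlongrightarrow> (\<integral>u. complex_of_real (exp (- A * u\<^sup>2)) \<partial>lborel)) at_top"
  proof (rule integral_dominated_convergence_at_top)
    show "integrable lborel (\<lambda>u. C / (1 + u\<^sup>2))"
      using integrable_mult_right[OF integrable_inverse_1_plus_square[unfolded set_integrable_def], of C]
      by (simp add: divide_inverse)
    show "saddle_integrand (inverse t) \<in> borel_measurable lborel" for t
      unfolding saddle_integrand_def saddle_tilt_def tilt_def gf_def by measurable
    show "AE u in lborel. ((\<lambda>t. saddle_integrand (inverse t) u) \<longlongrightarrow> complex_of_real (exp (- A * u\<^sup>2))) at_top"
      using tendsto_saddle_integrand by (intro AE_I2) (simp only: filterlim_at_right_to_top)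
    show "\<forall>\<^sub>F t in at_top. AE u in lborel. norm (saddle_integrand (inverse t) u) \<le> C / (1 + u\<^sup>2)"
      using norm_saddle_integrand_le unfolding eventually_at_right_to_top by eventually_elim simp
  qed auto
  thus ?thesis
    using integral_gaussian[OF A_pos] by (simp add: filterlim_at_right_to_top)
qed

lemma integral_saddle_integrand:
  assumes "0 < t" and n: "real n = A / t\<^sup>2"
  shows "(\<integral>u. saddle_integrand t u \<partial>lborel) = of_real (2 * pi * weight t n / (t * sqrt t))"
proof -
  define d where "d = t * sqrt t"
  have d: "0 < d" using assms by (simp add: d_def)
  have "(LBINT \<theta>:{-pi..pi}. tilt t (real n) (\<i> * of_real \<theta>))
      = \<bar>d\<bar> *\<^sub>R (\<integral>u. indicator {-pi..pi} (0 + d * u) *\<^sub>R tilt t (real n) (\<i> * of_real (0 + d * u)) \<partial>lborel)"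
    unfolding set_lebesgue_integral_def using d by (intro lborel_integral_real_affine) auto
  also have "(\<lambda>u. indicator {-pi..pi} (0 + d * u) *\<^sub>R tilt t (real n) (\<i> * of_real (0 + d * u)))
      = saddle_integrand t"
  proof
    fix u
    have "d * u \<in> {-pi..pi} \<longleftrightarrow> u \<in> {-(pi / d)..pi / d}" using d by (auto simp: field_simps)
    thus "indicator {-pi..pi} (0 + d * u) *\<^sub>R tilt t (real n) (\<i> * of_real (0 + d * u))
        = saddle_integrand t u"
      by (simp add: saddle_integrand_def saddle_tilt_def n d_def indicator_def mult_ac)
  qed
  finally have "of_real (2 * pi * weight t n) = of_real d * (\<integral>u. saddle_integrand t u \<partial>lborel)"
    unfolding coefficient_eq_integral_tilt[OF assms(1)] using d by (simp only: scaleR_conv_of_real abs_of_pos)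
  thus ?thesis
    using d unfolding d_def[symmetric] of_real_divide[of _ d] by (simp only:) simp
qed

definition saddle :: "nat \<Rightarrow> real" where
  "saddle n = sqrt (A / real n)"

lemma saddle_lim: "filterlim saddle (at_right 0) sequentially"
  unfolding saddle_def[abs_def] using A_pos by real_asymp

lemma saddle_pos: "0 < n \<Longrightarrow> 0 < saddle n"
  and of_nat_eq_saddle: "0 < n \<Longrightarrow> real n = A / (saddle n)\<^sup>2"
  using A_pos by (auto simp: saddle_def)

lemma tendsto_coefficient_saddle:
  "(\<lambda>n. 2 * pi * weight (saddle n) n / (saddle n * sqrt (saddle n)))
     \<longlonglongrightarrow> sqrt (pi / A)"
proof -
  have "(\<lambda>n. complex_of_real (2 * pi * weight (saddle n) n / (saddle n * sqrt (saddle n))))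
      \<longlonglongrightarrow> of_real (sqrt (pi / A))"
    by (rule Lim_transform_eventually[OF filterlim_compose[OF tendsto_integral_saddle_integrand saddle_lim]
          eventually_mono[OF eventually_gt_at_top[of 0]]])
       (rule integral_saddle_integrand[OF saddle_pos of_nat_eq_saddle])
  thus ?thesis by (simp only: tendsto_of_real_iff)
qed

lemma saddle_contribution:
  assumes "0 < n"
  shows "sqrt (pi / A) * (K * saddle n powr \<beta> * exp (A / saddle n))
           * (saddle n * sqrt (saddle n) * exp (A / saddle n) / (2 * pi))
       = K / (2 * sqrt (pi * A)) * (A / real n) powr (\<beta> / 2 + 3 / 4) * exp (2 * sqrt (A * real n))"
proof -
  have "A * real n = (A / saddle n)\<^sup>2"
    using A_pos of_nat_eq_saddle[OF assms] by (simp add: power2_eq_square)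
  hence "sqrt (A * real n) = A / saddle n" using A_pos saddle_pos[OF assms] by simp
  hence exponential: "exp (A / saddle n) * exp (A / saddle n) = exp (2 * sqrt (A * real n))"
    by (simp flip: exp_add)
  have "saddle n = (A / real n) powr (1 / 2)" using A_pos by (simp add: saddle_def powr_half_sqrt)
  hence power: "saddle n powr \<beta> * (saddle n * sqrt (saddle n)) = (A / real n) powr (\<beta> / 2 + 3 / 4)"
    by (simp add: powr_powr powr_half_sqrt[symmetric] add.commute flip: powr_add)
  have const: "sqrt (pi / A) / (2 * pi) = 1 / (2 * sqrt (pi * A))"
    using A_pos by (simp add: real_sqrt_mult real_sqrt_divide field_simps)
  have "sqrt (pi / A) * (K * saddle n powr \<beta> * exp (A / saddle n))
          * (saddle n * sqrt (saddle n) * exp (A / saddle n) / (2 * pi))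
      = K * (sqrt (pi / A) / (2 * pi)) * (saddle n powr \<beta> * (saddle n * sqrt (saddle n)))
          * (exp (A / saddle n) * exp (A / saddle n))"
    by simp
  thus ?thesis unfolding const power exponential by simp
qed

theorem coefficient_asymptotics:
  "s \<sim>[at_top] (\<lambda>n. K / (2 * sqrt (pi * A)) * (A / real n) powr (\<beta> / 2 + 3 / 4) * exp (2 * sqrt (A * real n)))"
proof (rule asymp_equiv_transfer)
  let ?g = "\<lambda>n. gf (exp (- saddle n))"
  let ?w = "\<lambda>n. saddle n * sqrt (saddle n) * exp (A / saddle n) / (2 * pi)"
  have "(\<lambda>n. 2 * pi * weight (saddle n) n / (saddle n * sqrt (saddle n)))
      \<sim>[at_top] (\<lambda>_. sqrt (pi / A))"
    using A_pos by (intro tendsto_imp_asymp_equiv_const tendsto_coefficient_saddle) auto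
  moreover have "?g \<sim>[at_top] (\<lambda>n. K * saddle n powr \<beta> * exp (A / saddle n))"
    by (rule asymp_equiv_compose'[OF gf_asymp saddle_lim])
  ultimately show "(\<lambda>n. 2 * pi * weight (saddle n) n / (saddle n * sqrt (saddle n)) * ?g n * ?w n)
      \<sim>[at_top] (\<lambda>n. sqrt (pi / A) * (K * saddle n powr \<beta> * exp (A / saddle n)) * ?w n)"
    by (intro asymp_equiv_intros)
  show "\<forall>\<^sub>F n in sequentially. sqrt (pi / A) * (K * saddle n powr \<beta> * exp (A / saddle n)) * ?w n
      = K / (2 * sqrt (pi * A)) * (A / real n) powr (\<beta> / 2 + 3 / 4) * exp (2 * sqrt (A * real n))"
    using eventually_gt_at_top[of 0] by eventually_elim (rule saddle_contribution)
  show "\<forall>\<^sub>F n in sequentially.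
      2 * pi * weight (saddle n) n / (saddle n * sqrt (saddle n)) * ?g n * ?w n = s n"
    using eventually_compose_filterlim[OF eventually_gf_pos saddle_lim] eventually_gt_at_top[of 0]
  proof eventually_elim
    case (elim n)
    have "exp (- saddle n) ^ n = exp (- (real n * saddle n))" by (rule exp_minus_mult_eq_power[symmetric])
    also have "real n * saddle n = A / saddle n"
      using of_nat_eq_saddle[OF elim(2)] by (simp add: power2_eq_square)
    finally show ?case using elim saddle_pos[OF elim(2)] by (simp add: weight_def exp_minus field_simps)
  qed
qed

end

section \<open>Partitions with restricted multiplicities\<close>

lemma norm_summable_on_mult_Times:
  fixes f :: "'b \<Rightarrow> 'a :: real_normed_field" and g :: "'c \<Rightarrow> 'a"
  assumes "(\<lambda>x. norm (f x)) summable_on A" "(\<lambda>y. norm (g y)) summable_on B"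
  shows "(\<lambda>(x, y). norm (f x * g y)) summable_on A \<times> B"
proof (rule summable_on_SigmaI)
  show "((\<lambda>y. case (x, y) of (x, y) \<Rightarrow> norm (f x * g y)) has_sum (norm (f x) * (\<Sum>\<^sub>\<infinity>y\<in>B. norm (g y)))) B" for x
    unfolding prod.case norm_mult by (intro has_sum_cmult_right has_sum_infsum assms)
  show "(\<lambda>x. norm (f x) * (\<Sum>\<^sub>\<infinity>y\<in>B. norm (g y))) summable_on A"
    by (intro summable_on_cmult_left assms)
qed simp

lemma has_sum_mult_Times:
  fixes f :: "'b \<Rightarrow> 'a :: {real_normed_field, banach}" and g :: "'c \<Rightarrow> 'a"
  assumes "(\<lambda>x. norm (f x)) summable_on A" "(\<lambda>y. norm (g y)) summable_on B"
    and "(f has_sum a) A" "(g has_sum b) B"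
  shows "((\<lambda>(x, y). f x * g y) has_sum (a * b)) (A \<times> B)"
proof (rule has_sum_SigmaI)
  show "((\<lambda>y. case (x, y) of (x, y) \<Rightarrow> f x * g y) has_sum (f x * b)) B" for x
    unfolding prod.case by (intro has_sum_cmult_right assms)
  show "((\<lambda>x. f x * b) has_sum (a * b)) A"
    by (intro has_sum_cmult_left assms)
  show "(\<lambda>(x, y). f x * g y) summable_on A \<times> B"
    using abs_summable_summable[of "\<lambda>(x, y). f x * g y"] norm_summable_on_mult_Times[OF assms(1,2)]
    by (simp add: case_prod_unfold)
qed

definition restricted_partitions :: "(nat \<Rightarrow> nat set) \<Rightarrow> nat \<Rightarrow> nat multiset set" where
  "restricted_partitions M n = {p \<in> partitions_of n. \<forall>k>0. count p k \<in> M k}"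

definition restricted_upto :: "(nat \<Rightarrow> nat set) \<Rightarrow> nat \<Rightarrow> nat multiset set" where
  "restricted_upto M N = {p. set_mset p \<subseteq> {1..N} \<and> (\<forall>k\<in>{1..N}. count p k \<in> M k)}"

definition multiplicity_gf :: "nat set \<Rightarrow> 'a \<Rightarrow> 'a :: {real_normed_field, banach}" where
  "multiplicity_gf C x = (\<Sum>\<^sub>\<infinity>c\<in>C. x ^ c)"

lemma power_has_sum_UNIV:
  fixes x :: "'a :: {real_normed_field, banach}"
  assumes "norm x < 1"
  shows "((\<lambda>c. x ^ c) has_sum (1 / (1 - x))) UNIV"
  by (rule norm_summable_imp_has_sum)
     (use assms in \<open>auto simp: norm_power intro!: geometric_sums summable_geometric\<close>)

lemma norm_powers_summable_on:
  fixes x :: "'a :: {real_normed_field, banach}"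
  assumes "norm x < 1"
  shows "(\<lambda>c. norm (x ^ c)) summable_on C"
  using summable_on_subset_banach[OF has_sum_imp_summable[OF power_has_sum_UNIV[of "norm x"]]] assms
  by (simp add: norm_power)

lemma multiplicity_gf_has_sum:
  fixes x :: "'a :: {real_normed_field, banach}"
  assumes "norm x < 1"
  shows "((\<lambda>c. x ^ c) has_sum multiplicity_gf C x) C"
  unfolding multiplicity_gf_def
  by (rule has_sum_infsum[OF abs_summable_summable[OF norm_powers_summable_on[OF assms]]])

lemma multiplicity_gf_simps:
  fixes x :: "'a :: {real_normed_field, banach}"
  shows "multiplicity_gf {1} x = x"
    and "multiplicity_gf {0, 1} x = 1 + x"
    and "norm x < 1 \<Longrightarrow> multiplicity_gf UNIV x = 1 / (1 - x)"
  using power_has_sum_UNIV[of x] by (auto simp: multiplicity_gf_def infsumI)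

lemma multiplicity_gf_bounds:
  fixes x :: real
  assumes "0 \<le> x" "x < 1"
  shows "0 \<le> multiplicity_gf C x" "multiplicity_gf C x \<le> 1 / (1 - x)"
proof -
  have "((\<lambda>c. x ^ c) has_sum multiplicity_gf C x) C"
    using assms by (intro multiplicity_gf_has_sum) auto
  moreover have "((\<lambda>c. x ^ c) has_sum (1 / (1 - x))) UNIV"
    using assms by (intro power_has_sum_UNIV) auto
  ultimately show "multiplicity_gf C x \<le> 1 / (1 - x)"
    by (rule has_sum_mono2) (use assms in auto)
  show "0 \<le> multiplicity_gf C x"
    unfolding multiplicity_gf_def using assms by (intro infsum_nonneg) auto
qed

lemma restricted_upto_0: "restricted_upto M 0 = {{#}}"
  by (auto simp: restricted_upto_def)

lemma bij_betw_restricted_upto_Suc: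
  "bij_betw (\<lambda>(p, c). p + replicate_mset c (Suc N))
     (restricted_upto M N \<times> M (Suc N)) (restricted_upto M (Suc N))"
proof (rule bij_betwI[where g = "\<lambda>p. (filter_mset (\<lambda>x. x \<noteq> Suc N) p, count p (Suc N))"])
  show "(\<lambda>(p, c). p + replicate_mset c (Suc N)) \<in> restricted_upto M N \<times> M (Suc N) \<rightarrow> restricted_upto M (Suc N)"
  proof clarify
    fix p c assume p: "p \<in> restricted_upto M N" and c: "c \<in> M (Suc N)"
    hence "count p (Suc N) = 0" by (force simp: restricted_upto_def not_in_iff)
    thus "p + replicate_mset c (Suc N) \<in> restricted_upto M (Suc N)"
      using p c by (auto simp: restricted_upto_def atLeastAtMostSuc_conv split: if_splits)
  qed
  show "(\<lambda>p. (filter_mset (\<lambda>x. x \<noteq> Suc N) p, count p (Suc N)))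
      \<in> restricted_upto M (Suc N) \<rightarrow> restricted_upto M N \<times> M (Suc N)"
  proof
    fix p assume p: "p \<in> restricted_upto M (Suc N)"
    hence "filter_mset (\<lambda>x. x \<noteq> Suc N) p \<in> restricted_upto M N"
      by (auto simp: restricted_upto_def le_Suc_eq)
    moreover have "count p (Suc N) \<in> M (Suc N)"
      using p by (auto simp: restricted_upto_def)
    ultimately show "(filter_mset (\<lambda>x. x \<noteq> Suc N) p, count p (Suc N)) \<in> restricted_upto M N \<times> M (Suc N)"
      by simp
  qed
  fix x assume "x \<in> restricted_upto M N \<times> M (Suc N)"
  then obtain p c where x: "x = (p, c)" "p \<in> restricted_upto M N" by auto
  have "Suc N \<notin># p" using x by (auto simp: restricted_upto_def)
  hence "filter_mset (\<lambda>x. x \<noteq> Suc N) p = p" "count p (Suc N) = 0"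
    by (auto simp: filter_mset_eq_conv) (simp add: not_in_iff)
  thus "(filter_mset (\<lambda>x. x \<noteq> Suc N) (case x of (p, c) \<Rightarrow> p + replicate_mset c (Suc N)),
         count (case x of (p, c) \<Rightarrow> p + replicate_mset c (Suc N)) (Suc N)) = x"
    by (simp add: x(1))
next
  fix p assume "p \<in> restricted_upto M (Suc N)"
  show "(case (filter_mset (\<lambda>x. x \<noteq> Suc N) p, count p (Suc N)) of (p, c) \<Rightarrow> p + replicate_mset c (Suc N)) = p"
    by (auto intro!: multiset_eqI)
qed

lemma restricted_upto_Suc_has_sum_iff:
  fixes q :: "'a :: real_normed_field"
  shows "((\<lambda>p. q ^ sum_mset p) has_sum S) (restricted_upto M (Suc N)) \<longleftrightarrow>
         ((\<lambda>(p, c). q ^ sum_mset p * (q ^ Suc N) ^ c) has_sum S) (restricted_upto M N \<times> M (Suc N))"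
proof -
  have "q ^ sum_mset (p + replicate_mset c (Suc N)) = q ^ sum_mset p * (q ^ Suc N) ^ c" for p c
    by (simp only: sum_mset.union sum_mset_replicate_mset of_nat_id power_add power_mult mult.commute[of c])
  thus ?thesis
    using has_sum_reindex_bij_betw[OF bij_betw_restricted_upto_Suc[of N M], of "\<lambda>p. q ^ sum_mset p" S]
    by (simp only: case_prod_unfold)
qed

lemma restricted_upto_summable:
  fixes r :: real
  assumes "0 \<le> r" "r < 1"
  shows "(\<lambda>p. r ^ sum_mset p) summable_on restricted_upto M N"
proof (induction N)
  case 0
  show ?case by (simp add: restricted_upto_0)
next
  case (Suc N)
  have "(\<lambda>(p, c). norm (r ^ sum_mset p * (r ^ Suc N) ^ c)) summable_on restricted_upto M N \<times> M (Suc N)"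
    using assms Suc.IH
    by (intro norm_summable_on_mult_Times norm_powers_summable_on)
       (simp_all add: norm_power power_less_one_iff del: power_Suc)
  hence "(\<lambda>(p, c). r ^ sum_mset p * (r ^ Suc N) ^ c) summable_on restricted_upto M N \<times> M (Suc N)"
    using assms(1) by (simp only: real_norm_def abs_mult power_abs abs_of_nonneg)
  thus ?case by (simp only: summable_on_def restricted_upto_Suc_has_sum_iff)
qed

lemma restricted_upto_has_sum:
  fixes q :: "'a :: {real_normed_field, banach}"
  assumes "norm q < 1"
  shows "((\<lambda>p. q ^ sum_mset p) has_sum (\<Prod>k=1..N. multiplicity_gf (M k) (q ^ k))) (restricted_upto M N)"
proof (induction N)
  case 0
  show ?case using has_sum_finite[of "{{#}}" "\<lambda>p. q ^ sum_mset p"] by (simp add: restricted_upto_0)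
next
  case (Suc N)
  let ?F = "\<lambda>k. multiplicity_gf (M k) (q ^ k)"
  have "(\<lambda>p. norm (q ^ sum_mset p)) summable_on restricted_upto M N"
    using restricted_upto_summable[of "norm q"] assms by (simp add: norm_power)
  moreover have "norm (q ^ Suc N) < 1" using assms by (simp add: norm_power power_less_one_iff del: power_Suc)
  ultimately have "((\<lambda>(p, c). q ^ sum_mset p * (q ^ Suc N) ^ c) has_sum ((\<Prod>k=1..N. ?F k) * ?F (Suc N)))
      (restricted_upto M N \<times> M (Suc N))"
    by (intro has_sum_mult_Times Suc.IH norm_powers_summable_on multiplicity_gf_has_sum)
  thus ?case
    by (simp only: restricted_upto_Suc_has_sum_iff prod.nat_ivl_Suc' mult.commute)
qed

lemma restricted_upto_subset_partitions_of: "{p \<in> restricted_upto M N. sum_mset p = n} \<subseteq> partitions_of n"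
proof
  fix p assume p: "p \<in> {p \<in> restricted_upto M N. sum_mset p = n}"
  hence "set_mset p \<subseteq> {1..N}" by (simp add: restricted_upto_def)
  hence "\<forall>k\<in>#p. 0 < k" by force
  thus "p \<in> partitions_of n" using p by (simp add: partitions_of_def)
qed

lemma card_restricted_upto_sums:
  fixes q :: "'a :: {real_normed_field, banach}"
  assumes "norm q < 1"
  shows "(\<lambda>n. of_nat (card {p \<in> restricted_upto M N. sum_mset p = n}) * q ^ n)
           sums (\<Prod>k=1..N. multiplicity_gf (M k) (q ^ k))"
proof -
  let ?P = "\<lambda>n. {p \<in> restricted_upto M N. sum_mset p = n}"
  have bij: "bij_betw snd (Sigma UNIV ?P) (restricted_upto M N)"
    by (rule bij_betwI[where g = "\<lambda>p. (sum_mset p, p)"]) (auto simp: Pi_iff)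
  have "((\<lambda>x. q ^ sum_mset (snd x)) has_sum (\<Prod>k=1..N. multiplicity_gf (M k) (q ^ k))) (Sigma UNIV ?P)"
    using restricted_upto_has_sum[OF assms] has_sum_reindex_bij_betw[OF bij, of "\<lambda>p. q ^ sum_mset p"] by simp
  hence "((\<lambda>n. of_nat (card (?P n)) * q ^ n) has_sum (\<Prod>k=1..N. multiplicity_gf (M k) (q ^ k))) UNIV"
  proof (rule has_sum_SigmaD)
    fix n
    have sum: "of_nat (card (?P n)) * q ^ n = (\<Sum>p\<in>?P n. q ^ sum_mset (snd (n, p)))" by simp
    show "((\<lambda>p. q ^ sum_mset (snd (n, p))) has_sum (of_nat (card (?P n)) * q ^ n)) (?P n)"
      unfolding sum
      by (rule has_sum_finite[OF finite_subset[OF restricted_upto_subset_partitions_of finite_partitions_of]])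
  qed
  thus ?thesis by (rule has_sum_imp_sums)
qed

lemma le_sum_mset: "k \<in># p \<Longrightarrow> k \<le> sum_mset p" for k :: nat
  by (metis le_add1 multi_member_split sum_mset.add_mset)

lemma restricted_upto_subset:
  assumes "\<And>k. K < k \<Longrightarrow> 0 \<in> M k" "K \<le> N"
  shows "{p \<in> restricted_upto M N. sum_mset p = n} \<subseteq> restricted_partitions M n"
proof
  fix p assume p: "p \<in> {p \<in> restricted_upto M N. sum_mset p = n}"
  have "count p k \<in> M k" if "0 < k" for k
  proof (cases "k \<le> N")
    case True
    thus ?thesis using p that by (auto simp: restricted_upto_def)
  next
    case False
    hence "k \<notin># p" using p by (auto simp: restricted_upto_def)
    thus ?thesis using False assms by (simp add: not_in_iff)
  qed
  thus "p \<in> restricted_partitions M n"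
    using subsetD[OF restricted_upto_subset_partitions_of p] by (simp add: restricted_partitions_def)
qed

lemma restricted_partitions_subset_upto:
  assumes "n \<le> N"
  shows "restricted_partitions M n \<subseteq> {p \<in> restricted_upto M N. sum_mset p = n}"
  using assms le_sum_mset order_trans[OF le_sum_mset]
  by (fastforce simp: restricted_partitions_def restricted_upto_def partitions_of_def Suc_le_eq)

lemma finite_restricted_partitions: "finite (restricted_partitions M n)"
  by (rule finite_subset[OF _ finite_partitions_of[of n]]) (auto simp: restricted_partitions_def)

lemma prod_multiplicity_gf_le:
  fixes r :: real
  assumes "0 \<le> r" "r < 1"
  shows "(\<Prod>k=1..N. multiplicity_gf (M k) (r ^ k)) \<le> exp (1 / (1 - r)\<^sup>2)"
proof -
  have "(\<Prod>k=1..N. multiplicity_gf (M k) (r ^ k)) \<le> (\<Prod>k=1..N. exp (r ^ k / (1 - r)))"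
  proof (rule prod_mono)
    fix k assume "k \<in> {1..N}"
    hence le: "r ^ k \<le> r" using assms power_decreasing[of 1 k r] by simp
    have "multiplicity_gf (M k) (r ^ k) \<le> 1 / (1 - r ^ k)"
      using assms le by (intro multiplicity_gf_bounds) auto
    also have "\<dots> = 1 + r ^ k / (1 - r ^ k)" using assms le by (simp add: field_simps)
    also have "\<dots> \<le> 1 + r ^ k / (1 - r)"
      using assms le by (intro add_left_mono divide_left_mono mult_pos_pos) auto
    also have "\<dots> \<le> exp (r ^ k / (1 - r))" by (rule exp_ge_add_one_self)
    finally show "0 \<le> multiplicity_gf (M k) (r ^ k) \<and> multiplicity_gf (M k) (r ^ k) \<le> exp (r ^ k / (1 - r))"
      using assms le by (auto intro: multiplicity_gf_bounds)
  qed
  also have "\<dots> = exp ((\<Sum>k=1..N. r ^ k) / (1 - r))" by (simp add: exp_sum sum_divide_distrib)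
  also have "(\<Sum>k=1..N. r ^ k) \<le> (\<Sum>k. r ^ k)"
    using assms by (intro sum_le_suminf summable_geometric) auto
  also have "\<dots> = 1 / (1 - r)" using assms by (intro suminf_geometric) auto
  finally show ?thesis using assms by (simp add: power2_eq_square divide_right_mono)
qed

lemma summable_card_restricted_partitions:
  fixes r :: real
  assumes "0 \<le> r" "r < 1"
  shows "summable (\<lambda>n. real (card (restricted_partitions M n)) * r ^ n)"
proof (rule summableI_nonneg_bounded)
  fix N
  let ?c = "\<lambda>n. real (card {p \<in> restricted_upto M N. sum_mset p = n}) * r ^ n"
  have c_sums: "?c sums (\<Prod>k=1..N. multiplicity_gf (M k) (r ^ k))"
    using card_restricted_upto_sums[of r M N] assms by simp
  have "(\<Sum>n<N. real (card (restricted_partitions M n)) * r ^ n) \<le> (\<Sum>n<N. ?c n)"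
    using assms
    by (intro sum_mono mult_right_mono of_nat_mono card_mono restricted_partitions_subset_upto
        finite_subset[OF restricted_upto_subset_partitions_of finite_partitions_of]) auto
  also have "\<dots> \<le> (\<Sum>n. ?c n)"
    using c_sums assms by (intro sum_le_suminf) (auto simp: sums_iff)
  also have "\<dots> = (\<Prod>k=1..N. multiplicity_gf (M k) (r ^ k))" using c_sums by (simp add: sums_iff)
  also have "\<dots> \<le> exp (1 / (1 - r)\<^sup>2)" by (rule prod_multiplicity_gf_le[OF assms])
  finally show "(\<Sum>n<N. real (card (restricted_partitions M n)) * r ^ n) \<le> exp (1 / (1 - r)\<^sup>2)" .
qed (use assms in simp)

theorem tendsto_prod_multiplicity_gf:
  fixes q :: "'a :: {real_normed_field, banach}"
  assumes "norm q < 1" and zero_allowed: "\<And>k. K < k \<Longrightarrow> 0 \<in> M k"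
  shows "(\<lambda>N. \<Prod>k=1..N. multiplicity_gf (M k) (q ^ k)) \<longlonglongrightarrow> (\<Sum>n. of_nat (card (restricted_partitions M n)) * q ^ n)"
proof -
  define c where "c n N = of_nat (card {p \<in> restricted_upto M N. sum_mset p = n}) * q ^ n" for n N
  have "(\<lambda>N. \<Sum>n. c n N) \<longlonglongrightarrow> (\<Sum>n. of_nat (card (restricted_partitions M n)) * q ^ n)"
  proof (rule tendsto_suminf_dominated)
    show "c n \<longlonglongrightarrow> of_nat (card (restricted_partitions M n)) * q ^ n" for n
    proof (rule tendsto_eventually)
      show "\<forall>\<^sub>F N in sequentially. c n N = of_nat (card (restricted_partitions M n)) * q ^ n"
        using eventually_ge_at_top[of "max K n"]
      proof eventually_elim
        case (elim N)
        hence "{p \<in> restricted_upto M N. sum_mset p = n} = restricted_partitions M n"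
          by (intro antisym restricted_upto_subset[OF zero_allowed] restricted_partitions_subset_upto) auto
        thus ?case by (simp add: c_def)
      qed
    qed
    show "\<forall>\<^sub>F N in sequentially. \<forall>n. norm (c n N) \<le> real (card (restricted_partitions M n)) * norm q ^ n"
    proof (rule eventually_mono[OF eventually_ge_at_top[of K]], rule allI)
      fix N n assume "K \<le> N"
      hence "card {p \<in> restricted_upto M N. sum_mset p = n} \<le> card (restricted_partitions M n)"
        by (intro card_mono finite_restricted_partitions restricted_upto_subset[OF zero_allowed])
      thus "norm (c n N) \<le> real (card (restricted_partitions M n)) * norm q ^ n"
        by (simp add: c_def norm_mult norm_power mult_right_mono)
    qed
    show "summable (\<lambda>n. real (card (restricted_partitions M n)) * norm q ^ n)"
      using assms(1) by (intro summable_card_restricted_partitions) auto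
  qed simp
  moreover have "(\<Sum>n. c n N) = (\<Prod>k=1..N. multiplicity_gf (M k) (q ^ k))" for N
    using card_restricted_upto_sums[OF assms(1), of M N] by (simp add: c_def sums_iff)
  ultimately show ?thesis by simp
qed

section \<open>Partitions without repeated odd parts\<close>

definition has_initial_odds :: "nat \<Rightarrow> nat multiset \<Rightarrow> bool" where
  "has_initial_odds m p \<longleftrightarrow> (\<forall>k. odd k \<and> k < 2 * m \<longrightarrow> k \<in># p)"

definition pod_count :: "nat \<Rightarrow> nat \<Rightarrow> nat" where
  "pod_count m n = card {p \<in> P_od n. has_initial_odds m p}"

definition pod_multiplicities :: "nat \<Rightarrow> nat \<Rightarrow> nat set" where
  "pod_multiplicities m k = (if odd k then if k < 2 * m then {1} else {0, 1} else UNIV)"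

definition pod_factor :: "nat \<Rightarrow> nat \<Rightarrow> 'a \<Rightarrow> 'a :: real_normed_field" where
  "pod_factor m k q = (if odd k then if k < 2 * m then q ^ k else 1 + q ^ k else 1 / (1 - q ^ k))"

lemma restricted_partitions_pod_multiplicities:
  "restricted_partitions (pod_multiplicities m) n = {p \<in> P_od n. has_initial_odds m p}"
proof -
  have "(\<forall>k>0. count p k \<in> pod_multiplicities m k)
      \<longleftrightarrow> (\<forall>k. odd k \<longrightarrow> count p k \<le> 1) \<and> has_initial_odds m p" for p
  proof -
    have "count p k \<in> pod_multiplicities m k
        \<longleftrightarrow> (odd k \<longrightarrow> count p k \<le> 1) \<and> (odd k \<and> k < 2 * m \<longrightarrow> k \<in># p)" for k
      using count_greater_zero_iff[of p k]
      by (auto simp: pod_multiplicities_def simp del: count_greater_zero_iff)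
    thus ?thesis unfolding has_initial_odds_def by (metis odd_pos)
  qed
  thus ?thesis by (auto simp: restricted_partitions_def P_od_def)
qed

lemma multiplicity_gf_pod_multiplicities:
  fixes q :: "'a :: {real_normed_field, banach}"
  assumes "norm q < 1" "0 < k"
  shows "multiplicity_gf (pod_multiplicities m k) (q ^ k) = pod_factor m k q"
  using multiplicity_gf_simps[of "q ^ k"] assms
  by (simp add: pod_multiplicities_def pod_factor_def norm_power power_less_one_iff)

interpretation pod: nonneg_power_series "\<lambda>n. real (pod_count m n)" for m
proof
  show "summable (\<lambda>n. real (pod_count m n) * r ^ n)" if "0 \<le> r" "r < 1" for m r
    using summable_card_restricted_partitions[OF that, of "pod_multiplicities m"]
    by (simp add: restricted_partitions_pod_multiplicities pod_count_def)
qed auto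

lemma tendsto_prod_pod_factor:
  fixes q :: "'a :: {real_normed_field, banach}"
  assumes "norm q < 1"
  shows "(\<lambda>N. \<Prod>k=1..N. pod_factor m k q) \<longlonglongrightarrow> pod.gf m q"
proof -
  have "0 \<in> pod_multiplicities m k" if "2 * m < k" for k
    using that by (simp add: pod_multiplicities_def)
  hence "(\<lambda>N. \<Prod>k=1..N. multiplicity_gf (pod_multiplicities m k) (q ^ k))
      \<longlonglongrightarrow> (\<Sum>n. of_nat (card (restricted_partitions (pod_multiplicities m) n)) * q ^ n)"
    by (rule tendsto_prod_multiplicity_gf[OF assms])
  hence "(\<lambda>N. \<Prod>k=1..N. multiplicity_gf (pod_multiplicities m k) (q ^ k)) \<longlonglongrightarrow> pod.gf m q"
    by (simp add: pod.gf_def restricted_partitions_pod_multiplicities flip: pod_count_def)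
  moreover have "(\<Prod>k=1..N. multiplicity_gf (pod_multiplicities m k) (q ^ k))
      = (\<Prod>k=1..N. pod_factor m k q)" for N
    using assms by (intro prod.cong multiplicity_gf_pod_multiplicities) auto
  ultimately show ?thesis by (simp only:)
qed

lemma prod_pod_factor_Suc:
  fixes r :: real
  assumes "0 \<le> r" "2 * m + 1 \<le> N"
  shows "(\<Prod>k=1..N. pod_factor (Suc m) k r)
       = (\<Prod>k=1..N. pod_factor m k r) * (r ^ (2 * m + 1) / (1 + r ^ (2 * m + 1)))"
proof -
  let ?k = "2 * m + 1"
  have k: "?k \<in> {1..N}" using assms(2) by auto
  have "(\<Prod>k\<in>{1..N} - {?k}. pod_factor m k r) = (\<Prod>k\<in>{1..N} - {?k}. pod_factor (Suc m) k r)"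
  proof (rule prod.cong[OF refl])
    fix k assume "k \<in> {1..N} - {?k}"
    hence "odd k \<Longrightarrow> k < 2 * m \<longleftrightarrow> k < 2 * Suc m" by (auto elim!: oddE)
    thus "pod_factor m k r = pod_factor (Suc m) k r" by (simp add: pod_factor_def)
  qed
  moreover have "pod_factor m ?k r = 1 + r ^ ?k" "pod_factor (Suc m) ?k r = r ^ ?k"
    by (simp_all add: pod_factor_def)
  moreover have "1 + r ^ ?k \<noteq> 0" using zero_le_power[OF assms(1), of ?k] by linarith
  ultimately show ?thesis
    unfolding prod.remove[OF finite_atLeastAtMost k] by simp
qed

lemma pod_gf_Suc:
  fixes r :: real
  assumes "0 \<le> r" "r < 1"
  shows "pod.gf (Suc m) r = pod.gf m r * (r ^ (2 * m + 1) / (1 + r ^ (2 * m + 1)))"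
proof (rule LIMSEQ_unique)
  have tendsto: "(\<lambda>N. \<Prod>k=1..N. pod_factor m k r) \<longlonglongrightarrow> pod.gf m r" for m
    using assms by (intro tendsto_prod_pod_factor) auto
  show "(\<lambda>N. \<Prod>k=1..N. pod_factor (Suc m) k r) \<longlonglongrightarrow> pod.gf (Suc m) r" by (rule tendsto)
  show "(\<lambda>N. \<Prod>k=1..N. pod_factor (Suc m) k r) \<longlonglongrightarrow> pod.gf m r * (r ^ (2 * m + 1) / (1 + r ^ (2 * m + 1)))"
  proof (rule Lim_transform_eventually[OF tendsto_mult_right[OF tendsto]])
    show "\<forall>\<^sub>F N in sequentially. (\<Prod>k=1..N. pod_factor m k r) * (r ^ (2 * m + 1) / (1 + r ^ (2 * m + 1)))
        = (\<Prod>k=1..N. pod_factor (Suc m) k r)"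
      using eventually_ge_at_top[of "2 * m + 1"]
      by eventually_elim (use assms in \<open>simp only: prod_pod_factor_Suc\<close>)
  qed
qed

definition odd_ratio :: "nat \<Rightarrow> real \<Rightarrow> real" where
  "odd_ratio m r = (\<Prod>j<m. r ^ (2 * j + 1) / (1 + r ^ (2 * j + 1)))"

lemma pod_gf_eq_odd_ratio:
  assumes "0 \<le> r" "r < 1"
  shows "pod.gf m r = pod.gf 0 r * odd_ratio m r"
  by (induction m) (simp_all add: pod_gf_Suc[OF assms] odd_ratio_def)

lemma odd_ratio_bounds:
  assumes "0 \<le> r" "r < 1"
  shows "0 \<le> odd_ratio m r" "odd_ratio m r \<le> (1 / 2) ^ m"
proof -
  have factor: "0 \<le> r ^ j / (1 + r ^ j) \<and> r ^ j / (1 + r ^ j) \<le> 1 / 2" for j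
  proof -
    have "0 \<le> r ^ j" "r ^ j \<le> 1" using assms by (auto intro: power_le_one)
    thus ?thesis by (simp add: field_simps)
  qed
  show "0 \<le> odd_ratio m r" unfolding odd_ratio_def using factor by (intro prod_nonneg) blast
  have "odd_ratio m r \<le> (\<Prod>j<m. 1 / 2)" unfolding odd_ratio_def by (rule prod_mono) (rule factor)
  thus "odd_ratio m r \<le> (1 / 2) ^ m" by simp
qed

lemma tendsto_odd_ratio: "((\<lambda>t. odd_ratio m (exp (- t))) \<longlongrightarrow> (1 / 2) ^ m) (at_right 0)"
proof -
  have "((\<lambda>t :: real. exp (- t)) \<longlongrightarrow> 1) (at_right 0)" by real_asymp
  hence "((\<lambda>t. odd_ratio m (exp (- t))) \<longlongrightarrow> (\<Prod>j<m. 1 ^ (2 * j + 1) / (1 + 1 ^ (2 * j + 1)))) (at_right 0)"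
    unfolding odd_ratio_def by (intro tendsto_intros) auto
  thus ?thesis by (simp add: power_divide)
qed

lemma prod_pod_factor_0:
  fixes q :: real
  assumes "0 < q" "q < 1"
  shows "(\<Prod>k=1..2 * N. pod_factor 0 k q) =
     (\<Prod>k=1..2 * N. 1 - (q\<^sup>2) ^ k) / ((\<Prod>k=1..N. 1 - (q ^ 4) ^ k) * (\<Prod>k=1..2 * N. 1 - q ^ k))"
proof (induction N)
  case (Suc N)
  define x y where "x = q ^ (2 * N + 1)" and "y = q ^ (2 * N + 2)"
  have xy: "0 < x" "x < 1" "0 < y" "y < 1"
    using assms by (auto simp: x_def y_def power_less_one_iff simp del: power_Suc)
  have squares: "(q\<^sup>2) ^ (2 * N + 1) = x\<^sup>2" "(q\<^sup>2) ^ (2 * N + 2) = y\<^sup>2"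
    by (simp_all only: x_def y_def power_mult[symmetric] mult.commute)
  have fourth: "(q ^ 4) ^ (N + 1) = y\<^sup>2"
    unfolding y_def power_mult[symmetric] by (rule arg_cong[of _ _ "\<lambda>e. q ^ e"]) simp
  have factors: "pod_factor 0 (2 * N + 1) q = 1 + x" "pod_factor 0 (2 * N + 2) q = 1 / (1 - y)"
    by (simp_all add: pod_factor_def x_def y_def)
  have split2: "(\<Prod>k=1..2 * Suc N. h k) = (\<Prod>k=1..2 * N. h k) * h (2 * N + 1) * h (2 * N + 2)"
    for h :: "nat \<Rightarrow> real"
    by simp
  have split1: "(\<Prod>k=1..Suc N. h k) = (\<Prod>k=1..N. h k) * h (N + 1)" for h :: "nat \<Rightarrow> real"
    by simp
  have "(\<Prod>k=1..2 * Suc N. pod_factor 0 k q) = (\<Prod>k=1..2 * N. pod_factor 0 k q) * ((1 + x) * (1 / (1 - y)))"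
    unfolding split2 factors by (simp only: mult.assoc)
  also have "(1 + x) * (1 / (1 - y)) = ((1 - x\<^sup>2) * (1 - y\<^sup>2)) / ((1 - y\<^sup>2) * ((1 - x) * (1 - y)))"
  proof -
    have "y\<^sup>2 \<noteq> 1" using xy by (simp add: power2_eq_1_iff)
    moreover have "1 - x\<^sup>2 = (1 - x) * (1 + x)" by (simp add: power2_eq_square algebra_simps)
    ultimately show ?thesis using xy by (simp only:) simp
  qed
  finally show ?case
    unfolding Suc.IH split2 split1 squares fourth x_def[symmetric] y_def[symmetric]
    by (simp only: times_divide_times_eq mult_ac)
qed simp

lemma pod_gf_0_eq:
  assumes "0 < t"
  shows "pod.gf 0 (exp (- t)) = exp (ln_partition_gf t + ln_partition_gf (4 * t) - ln_partition_gf (2 * t))"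
proof -
  define q where "q = exp (- t)"
  have q: "0 < q" "q < 1" using assms by (auto simp: q_def)
  have q2: "exp (- (2 * t)) = q\<^sup>2" and q4: "exp (- (4 * t)) = q ^ 4"
    unfolding q_def by (simp_all flip: exp_of_nat_mult)
  have double: "filterlim (\<lambda>N::nat. 2 * N) sequentially sequentially"
    by (rule mult_nat_left_at_top) simp
  have "(\<lambda>N. (\<Prod>k=1..2 * N. 1 - (q\<^sup>2) ^ k) / ((\<Prod>k=1..N. 1 - (q ^ 4) ^ k) * (\<Prod>k=1..2 * N. 1 - q ^ k)))
     \<longlonglongrightarrow> exp (- ln_partition_gf (2 * t)) / (exp (- ln_partition_gf (4 * t)) * exp (- ln_partition_gf t))"
    using tendsto_prod_one_minus_power[of "4 * t"]
      filterlim_compose[OF tendsto_prod_one_minus_power[of "2 * t"] double]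
      filterlim_compose[OF tendsto_prod_one_minus_power[of t] double] assms
    unfolding q2 q4 q_def[symmetric] by (intro tendsto_divide tendsto_mult) auto
  hence "(\<lambda>N. \<Prod>k=1..2 * N. pod_factor 0 k q)
      \<longlonglongrightarrow> exp (- ln_partition_gf (2 * t)) / (exp (- ln_partition_gf (4 * t)) * exp (- ln_partition_gf t))"
    by (simp only: prod_pod_factor_0[OF q])
  moreover have "(\<lambda>N. \<Prod>k=1..2 * N. pod_factor 0 k q) \<longlonglongrightarrow> pod.gf 0 q"
    by (rule filterlim_compose[OF tendsto_prod_pod_factor double]) (use q in auto)
  ultimately have "pod.gf 0 q
      = exp (- ln_partition_gf (2 * t)) / (exp (- ln_partition_gf (4 * t)) * exp (- ln_partition_gf t))"
    using LIMSEQ_unique by blast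
  thus ?thesis by (simp add: q_def exp_minus exp_add exp_diff field_simps)
qed

theorem pod_gf_0_asymptotics:
  "(\<lambda>t. pod.gf 0 (exp (- t))) \<sim>[at_right 0] (\<lambda>t. 1 / sqrt pi * t powr (1 / 2) * exp (pi\<^sup>2 / 8 / t))"
proof (rule asymp_equivI')
  define e where "e t = ln_partition_gf t - pi\<^sup>2 / (6 * t) - ln (t / (2 * pi)) / 2" for t
  have e_lim: "((\<lambda>t. e (c * t)) \<longlongrightarrow> 0) (at_right 0)" if "c > 0" for c :: real
  proof -
    have "filterlim (\<lambda>t. c * t) (at_right 0) (at_right 0)" using that by real_asymp
    from filterlim_compose[OF ln_partition_gf_asymptotics[folded e_def] this] show ?thesis .
  qed
  have "((\<lambda>t. exp (e (1 * t) + e (4 * t) - e (2 * t))) \<longlongrightarrow> exp (0 + 0 - 0)) (at_right 0)"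
    by (intro tendsto_intros e_lim) auto
  hence "((\<lambda>t. exp (e (1 * t) + e (4 * t) - e (2 * t))) \<longlongrightarrow> 1) (at_right 0)" by simp
  moreover have "\<forall>\<^sub>F t in at_right 0. exp (e (1 * t) + e (4 * t) - e (2 * t))
      = pod.gf 0 (exp (- t)) / (1 / sqrt pi * t powr (1 / 2) * exp (pi\<^sup>2 / 8 / t))"
    using eventually_at_right_less[of 0]
  proof eventually_elim
    case (elim t)
    have logs: "ln (t / (2 * pi)) / 2 + ln (4 * t / (2 * pi)) / 2 - ln (2 * t / (2 * pi)) / 2
        = ln (1 / sqrt pi * sqrt t)"
    proof -
      have "ln (4::real) = 2 * ln 2" using ln_realpow[of 2 2] by simp
      thus ?thesis using elim by (simp add: ln_div ln_mult ln_sqrt field_simps)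
    qed
    have poles: "pi\<^sup>2 / (6 * t) + pi\<^sup>2 / (6 * (4 * t)) - pi\<^sup>2 / (6 * (2 * t)) = pi\<^sup>2 / 8 / t"
      using elim by (simp add: field_simps)
    have "e (1 * t) + e (4 * t) - e (2 * t)
        = (ln_partition_gf t + ln_partition_gf (4 * t) - ln_partition_gf (2 * t))
            - ln (1 / sqrt pi * sqrt t) - pi\<^sup>2 / 8 / t"
      unfolding logs[symmetric] poles[symmetric] by (simp add: e_def)
    also have "exp \<dots> = pod.gf 0 (exp (- t)) / exp (ln (1 / sqrt pi * sqrt t)) / exp (pi\<^sup>2 / 8 / t)"
      unfolding pod_gf_0_eq[OF elim] by (simp only: exp_diff)
    also have "exp (ln (1 / sqrt pi * sqrt t)) = 1 / sqrt pi * t powr (1 / 2)"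
      using elim by (simp add: powr_half_sqrt)
    finally show ?case by simp
  qed
  ultimately show
    "((\<lambda>t. pod.gf 0 (exp (- t)) / (1 / sqrt pi * t powr (1 / 2) * exp (pi\<^sup>2 / 8 / t))) \<longlongrightarrow> 1) (at_right 0)"
    by (rule Lim_transform_eventually)
qed

section \<open>Bounds off the real axis\<close>

lemma norm_one_plus_squared: "(norm (1 + z))\<^sup>2 = (1 + norm z)\<^sup>2 - 2 * (norm z - Re z)"
proof -
  have "(norm (1 + z))\<^sup>2 = 1 + 2 * Re z + (norm z)\<^sup>2"
    unfolding cmod_power2 by (simp add: power2_eq_square algebra_simps)
  thus ?thesis by (simp add: power2_sum)
qed

lemma norm_one_minus_squared: "(norm (1 - z))\<^sup>2 = (1 - norm z)\<^sup>2 + 2 * (norm z - Re z)"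
  using norm_one_plus_squared[of "- z"] by (simp add: power2_eq_square algebra_simps)

lemma norm_one_plus_le:
  assumes "norm z < 1"
  shows "norm (1 + z) \<le> (1 + norm z) * exp (- ((norm z - Re z) / 4))"
proof (rule power2_le_imp_le)
  define y where "y = norm z - Re z"
  have y: "0 \<le> y" using complex_Re_le_cmod[of z] by (simp add: y_def)
  have "(1 + norm z)\<^sup>2 \<le> 2\<^sup>2" using assms by (intro power_mono) auto
  hence "(1 + norm z)\<^sup>2 * (y / 2) \<le> 4 * (y / 2)" using y by (intro mult_right_mono) auto
  hence "(norm (1 + z))\<^sup>2 \<le> (1 + norm z)\<^sup>2 * (1 - y / 2)"
    unfolding norm_one_plus_squared y_def[symmetric] by (simp add: right_diff_distrib)
  also have "\<dots> \<le> (1 + norm z)\<^sup>2 * exp (- (y / 2))"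
    using exp_ge_add_one_self[of "- (y / 2)"] by (intro mult_left_mono) auto
  also have "exp (- (y / 2)) = (exp (- (y / 4)))\<^sup>2" by (simp flip: exp_double)
  finally show "(norm (1 + z))\<^sup>2 \<le> ((1 + norm z) * exp (- ((norm z - Re z) / 4)))\<^sup>2"
    by (simp add: power_mult_distrib y_def)
qed auto

lemma norm_one_minus_ge:
  assumes "norm z < 1"
  shows "(1 - norm z) * exp ((norm z - Re z) / 4) \<le> norm (1 - z)"
proof (rule power2_le_imp_le)
  define y where "y = norm z - Re z"
  have y: "0 \<le> y" "y \<le> 2"
    using complex_Re_le_cmod[of z] abs_Re_le_cmod[of z] assms unfolding y_def by linarith+
  have "exp (y / 2) \<le> 1 + y / 2 + (y / 2)\<^sup>2" using y by (intro exp_bound) auto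
  also have "(y / 2)\<^sup>2 \<le> y / 2" using y mult_left_le[of "y / 2" "y / 2"] by (simp add: power2_eq_square)
  finally have exp_le: "exp (y / 2) \<le> 1 + 2 * y" using y by linarith
  have "((1 - norm z) * exp (y / 4))\<^sup>2 = (1 - norm z)\<^sup>2 * exp (y / 2)"
    by (simp add: power_mult_distrib flip: exp_double)
  also have "\<dots> \<le> (1 - norm z)\<^sup>2 * (1 + 2 * y)" by (intro mult_left_mono exp_le) auto
  also have "\<dots> \<le> (1 - norm z)\<^sup>2 + 1 * (2 * y)"
    unfolding distrib_left mult_1_right
    using assms y by (intro add_left_mono mult_right_mono power_le_one) auto
  also have "\<dots> = (norm (1 - z))\<^sup>2" by (simp add: norm_one_minus_squared y_def)
  finally show "((1 - norm z) * exp ((norm z - Re z) / 4))\<^sup>2 \<le> (norm (1 - z))\<^sup>2" by (simp only: y_def)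
qed simp

lemma norm_inverse_one_minus_le:
  assumes "norm z < 1"
  shows "norm (1 / (1 - z)) \<le> 1 / (1 - norm z) * exp (- ((norm z - Re z) / 4))"
proof -
  have "1 / norm (1 - z) \<le> 1 / ((1 - norm z) * exp ((norm z - Re z) / 4))"
    using assms norm_one_minus_ge[OF assms] by (intro frac_le) auto
  thus ?thesis by (simp only: norm_divide norm_one exp_minus) (simp add: field_simps)
qed

lemma norm_pod_factor_le:
  fixes q :: complex
  assumes "norm q < 1" "0 < k"
  shows "norm (pod_factor m k q)
       \<le> pod_factor m k (norm q) * (if 2 * m < k then exp (- ((norm q ^ k - Re (q ^ k)) / 4)) else 1)"
proof -
  let ?e = "exp (- ((norm q ^ k - Re (q ^ k)) / 4))"
  have norm_power_less: "norm (q ^ k) < 1" using assms by (simp add: norm_power power_less_one_iff)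
  have plus: "norm (1 + q ^ k) \<le> (1 + norm q ^ k) * ?e"
    using norm_one_plus_le[OF norm_power_less] by (simp add: norm_power)
  have minus_decay: "norm (1 / (1 - q ^ k)) \<le> 1 / (1 - norm q ^ k) * ?e"
    using norm_inverse_one_minus_le[OF norm_power_less] by (simp add: norm_power)
  also have "\<dots> \<le> 1 / (1 - norm q ^ k) * 1"
    using norm_power_less complex_Re_le_cmod[of "q ^ k"] by (intro mult_left_mono) (auto simp: norm_power)
  finally have minus: "norm (1 / (1 - q ^ k)) \<le> 1 / (1 - norm q ^ k)" by simp
  consider (forced) "odd k" "k < 2 * m" | (optional) "odd k" "2 * m < k" | (even) "even k"
    by (metis dvd_triv_left linorder_neqE_nat)
  thus ?thesis
  proof cases
    case forced
    thus ?thesis by (simp add: pod_factor_def norm_power)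
  next
    case optional
    thus ?thesis using plus by (simp add: pod_factor_def)
  next
    case even
    thus ?thesis using minus_decay minus by (simp add: pod_factor_def)
  qed
qed

definition pole_gap :: "complex \<Rightarrow> real" where
  "pole_gap q = 1 / (1 - norm q) - 1 / norm (1 - q)"

lemma pole_gap_nonneg:
  assumes "norm q < 1"
  shows "0 \<le> pole_gap q"
proof -
  have "1 - norm q \<le> norm (1 - q)" using norm_triangle_ineq2[of 1 q] by simp
  thus ?thesis using assms by (simp add: pole_gap_def frac_le)
qed

definition product_decay :: "nat \<Rightarrow> complex \<Rightarrow> real" where
  "product_decay m q = exp (- (norm q ^ (2 * m + 1) * pole_gap q / 4))"

lemma product_decay_bounds:
  assumes "norm q < 1"
  shows "0 \<le> product_decay m q" "product_decay m q \<le> 1"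
  using pole_gap_nonneg[OF assms] by (auto simp: product_decay_def)

lemma norm_prod_pod_factor_le:
  fixes q :: complex
  assumes "norm q < 1"
  shows "norm (\<Prod>k=1..2 * m + N. pod_factor m k q)
       \<le> (\<Prod>k=1..2 * m + N. pod_factor m k (norm q))
           * exp (- ((\<Sum>j<N. norm q ^ (2 * m + 1 + j) - Re (q ^ (2 * m + 1 + j))) / 4))"
proof -
  define a where "a k = norm q ^ k - Re (q ^ k)" for k
  let ?e = "\<lambda>k. if 2 * m < k then exp (- (a k / 4)) else 1"
  have "norm (\<Prod>k=1..2 * m + N. pod_factor m k q) \<le> (\<Prod>k=1..2 * m + N. pod_factor m k (norm q) * ?e k)"
    unfolding prod_norm[symmetric] a_def using assms by (intro prod_mono conjI norm_pod_factor_le) auto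
  also have "\<dots> = (\<Prod>k=1..2 * m + N. pod_factor m k (norm q)) * (\<Prod>k=1..2 * m + N. ?e k)"
    by (rule prod.distrib)
  also have "(\<Prod>k=1..2 * m + N. ?e k) = (\<Prod>k\<in>{2 * m + 1..2 * m + N}. exp (- (a k / 4)))"
    by (rule prod.mono_neutral_cong_right) auto
  also have "\<dots> = (\<Prod>j<N. exp (- (a (2 * m + 1 + j) / 4)))"
    by (rule prod.reindex_bij_witness[of _ "\<lambda>j. 2 * m + 1 + j" "\<lambda>k. k - (2 * m + 1)"]) auto
  also have "\<dots> = exp (- ((\<Sum>j<N. a (2 * m + 1 + j)) / 4))"
    by (simp add: exp_sum sum_negf[symmetric] sum_divide_distrib)
  finally show ?thesis by (simp only: a_def)
qed

lemma power_minus_Re_power_sums: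
  fixes q :: complex
  assumes "norm q < 1"
  shows "(\<lambda>j. norm q ^ (k + j) - Re (q ^ (k + j))) sums (norm q ^ k / (1 - norm q) - Re (q ^ k / (1 - q)))"
proof -
  have "(\<lambda>j. norm q ^ k * norm q ^ j - Re (q ^ k * q ^ j))
      sums (norm q ^ k * (1 / (1 - norm q)) - Re (q ^ k * (1 / (1 - q))))"
    using assms by (intro sums_diff sums_Re sums_mult geometric_sums) auto
  thus ?thesis by (simp only: power_add times_divide_eq_right mult_1_right)
qed

theorem norm_pod_gf_le:
  fixes q :: complex
  assumes "norm q < 1"
  shows "norm (pod.gf m q) \<le> pod.gf m (norm q) * product_decay m q"
proof -
  define l where "l = norm q ^ (2 * m + 1) / (1 - norm q) - Re (q ^ (2 * m + 1) / (1 - q))"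
  have shift: "filterlim (\<lambda>N. 2 * m + N) sequentially sequentially"
    by (rule filterlim_add_const_nat_at_top[of "2 * m", unfolded add.commute[of _ "2 * m"]])
  have "norm (pod.gf m q) \<le> pod.gf m (norm q) * exp (- (l / 4))"
  proof (rule LIMSEQ_le)
    show "(\<lambda>N. norm (\<Prod>k=1..2 * m + N. pod_factor m k q)) \<longlonglongrightarrow> norm (pod.gf m q)"
      by (intro tendsto_norm filterlim_compose[OF tendsto_prod_pod_factor[OF assms] shift])
    show "(\<lambda>N. (\<Prod>k=1..2 * m + N. pod_factor m k (norm q))
            * exp (- ((\<Sum>j<N. norm q ^ (2 * m + 1 + j) - Re (q ^ (2 * m + 1 + j))) / 4)))
        \<longlonglongrightarrow> pod.gf m (norm q) * exp (- (l / 4))"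
      using power_minus_Re_power_sums[OF assms, of "2 * m + 1", folded l_def] assms unfolding sums_def
      by (intro tendsto_intros filterlim_compose[OF tendsto_prod_pod_factor shift]) auto
  qed (use norm_prod_pod_factor_le[OF assms] in auto)
  also have "\<dots> \<le> pod.gf m (norm q) * product_decay m q"
  proof -
    have "Re (q ^ (2 * m + 1) / (1 - q)) \<le> norm (q ^ (2 * m + 1) / (1 - q))" by (rule complex_Re_le_cmod)
    also have "\<dots> = norm q ^ (2 * m + 1) * (1 / norm (1 - q))" by (simp add: norm_divide norm_power norm_mult)
    finally have "norm q ^ (2 * m + 1) * pole_gap q \<le> l"
      unfolding l_def pole_gap_def right_diff_distrib by simp
    thus ?thesis
      using pod.gf_nonneg[of "norm q" m] assms unfolding product_decay_def by (intro mult_left_mono) auto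
  qed
  finally show ?thesis .
qed

section \<open>The generating function of the moex sums\<close>

lemma moex_odd: "odd (moex p)"
  and moex_notin: "moex p \<notin># p"
  and less_moexD: "odd k \<Longrightarrow> k < moex p \<Longrightarrow> k \<in># p"
proof -
  obtain b where "\<forall>k\<in>set_mset p. k \<le> b" using finite_nat_set_iff_bounded_le[of "set_mset p"] by auto
  hence "2 * b + 1 \<notin># p" by force
  hence "odd (2 * b + 1) \<and> 2 * b + 1 \<notin># p" by simp
  hence "odd (moex p) \<and> moex p \<notin># p" unfolding moex_def by (rule LeastI)
  thus "odd (moex p)" "moex p \<notin># p" by auto
  show "odd k \<Longrightarrow> k < moex p \<Longrightarrow> k \<in># p" unfolding moex_def using not_less_Least by blast
qed

lemma has_initial_odds_iff: "has_initial_odds m p \<longleftrightarrow> 2 * m < moex p"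
proof
  assume "has_initial_odds m p"
  hence "\<not> moex p < 2 * m" using moex_odd moex_notin by (auto simp: has_initial_odds_def)
  moreover have "moex p \<noteq> 2 * m" using moex_odd[of p] by auto
  ultimately show "2 * m < moex p" by linarith
qed (use less_moexD in \<open>auto simp: has_initial_odds_def\<close>)

lemma has_initial_odds_imp_le:
  assumes "has_initial_odds m p" "p \<in> P_od n"
  shows "m \<le> n"
proof (cases m)
  case (Suc i)
  have "2 * i + 1 \<in># p" using assms(1) Suc by (simp add: has_initial_odds_def)
  hence "2 * i + 1 \<le> sum_mset p" by (rule le_sum_mset)
  thus ?thesis using assms(2) Suc by (auto simp: P_od_def partitions_of_def)
qed simp

definition moex_weight :: "nat \<Rightarrow> nat" where
  "moex_weight m = (if m = 0 then 1 else 2)"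

lemma moex_weight_le: "moex_weight m \<le> 2"
  by (simp add: moex_weight_def)

lemma moex_eq_sum:
  assumes "p \<in> P_od n"
  shows "moex p = (\<Sum>m\<le>n. moex_weight m * of_bool (has_initial_odds m p))"
proof -
  obtain j where j: "moex p = 2 * j + 1" using moex_odd[of p] by (elim oddE)
  have iff: "has_initial_odds m p \<longleftrightarrow> m \<le> j" for m by (auto simp: has_initial_odds_iff j)
  hence "j \<le> n" using has_initial_odds_imp_le assms by blast
  hence "(\<Sum>m\<le>n. moex_weight m * of_bool (has_initial_odds m p)) = (\<Sum>m\<le>j. moex_weight m)"
    unfolding iff by (intro sum.mono_neutral_cong_right) auto
  also have "\<dots> = 2 * j + 1" by (induction j) (auto simp: moex_weight_def)
  finally show ?thesis by (simp only: j)
qed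

lemma sigma_od_moex_eq_sum: "sigma_od_moex n = (\<Sum>m\<le>n. moex_weight m * pod_count m n)"
proof -
  have "sigma_od_moex n = (\<Sum>m\<le>n. \<Sum>p\<in>P_od n. moex_weight m * of_bool (has_initial_odds m p))"
    unfolding sigma_od_moex_def by (subst sum.swap) (intro sum.cong refl moex_eq_sum)
  also have "\<dots> = (\<Sum>m\<le>n. moex_weight m * pod_count m n)"
    by (simp add: pod_count_def finite_P_od Int_def flip: sum_distrib_left)
  finally show ?thesis .
qed

lemma pod_count_eq_0: "n < m \<Longrightarrow> pod_count m n = 0"
  using has_initial_odds_imp_le[of m _ n] by (auto simp: pod_count_def card_eq_0_iff)

lemma summable_weighted_pod_gf:
  fixes r :: real
  assumes "0 \<le> r" "r < 1"
  shows "summable (\<lambda>m. real (moex_weight m) * pod.gf m r)"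
proof (rule summable_comparison_test)
  show "summable (\<lambda>m. (2 * pod.gf 0 r) * (1 / 2) ^ m)" by (intro summable_mult summable_geometric) simp
  have "real (moex_weight m) * pod.gf m r \<le> 2 * (pod.gf 0 r * (1 / 2) ^ m)" for m
    unfolding pod_gf_eq_odd_ratio[OF assms, of m]
    using moex_weight_le[of m] odd_ratio_bounds[OF assms] pod.gf_nonneg[OF assms]
    by (intro mult_mono mult_nonneg_nonneg mult_left_mono) auto
  thus "\<exists>M. \<forall>m\<ge>M. norm (real (moex_weight m) * pod.gf m r) \<le> 2 * pod.gf 0 r * (1 / 2) ^ m"
    using pod.gf_nonneg[OF assms] by (simp add: abs_mult mult.assoc)
qed

lemma sigma_od_moex_power_series:
  fixes q :: "'a :: {real_normed_field, banach}"
  assumes "norm q < 1"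
  shows "summable (\<lambda>m. of_nat (moex_weight m) * pod.gf m q)"
    and "(\<lambda>n. of_nat (sigma_od_moex n) * q ^ n) sums (\<Sum>m. of_nat (moex_weight m) * pod.gf m q)"
proof -
  define f where "f m n = of_nat (moex_weight m) * (of_nat (pod_count m n) * q ^ n)" for m n
  have row_norms: "(\<lambda>n. norm (f m n)) sums (real (moex_weight m) * pod.gf m (norm q))" for m
    using sums_mult[OF pod.gf_sums[of "norm q" m], of "real (moex_weight m)"] assms
    by (simp add: f_def norm_mult norm_power)
  have summable_norms: "summable (\<lambda>m. real (moex_weight m) * pod.gf m (norm q))"
    using assms by (intro summable_weighted_pod_gf) auto
  have rows: "f m sums (of_nat (moex_weight m) * pod.gf m q)" for m
    using sums_mult[OF pod.gf_sums[OF assms, of m]] by (simp add: f_def[abs_def])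
  have columns: "(\<lambda>m. f m n) sums (of_nat (sigma_od_moex n) * q ^ n)" for n
    using sums_finite[of "{..n}" "\<lambda>m. f m n"]
    by (simp add: f_def pod_count_eq_0 sigma_od_moex_eq_sum sum_distrib_right mult.assoc)
  show "summable (\<lambda>m. of_nat (moex_weight m) * pod.gf m q)"
    and "(\<lambda>n. of_nat (sigma_od_moex n) * q ^ n) sums (\<Sum>m. of_nat (moex_weight m) * pod.gf m q)"
    by (rule sums_swap[OF row_norms summable_norms rows columns])+
qed

interpretation sigma: nonneg_power_series "\<lambda>n. real (sigma_od_moex n)"
proof
  show "summable (\<lambda>n. real (sigma_od_moex n) * r ^ n)" if "0 \<le> r" "r < 1" for r
    using sigma_od_moex_power_series(2)[of r] that by (simp add: sums_iff)
qed simp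

lemma sigma_gf_sums:
  fixes q :: "'a :: {real_normed_field, banach}"
  assumes "norm q < 1"
  shows "(\<lambda>m. of_nat (moex_weight m) * pod.gf m q) sums sigma.gf q"
proof -
  have "sigma.gf q = (\<Sum>m. of_nat (moex_weight m) * pod.gf m q)"
    using sums_unique2[OF sigma.gf_sums[OF assms]] sigma_od_moex_power_series(2)[OF assms] by simp
  thus ?thesis using sigma_od_moex_power_series(1)[OF assms] by (simp add: summable_sums)
qed

lemma pod_gf_0_le_sigma_gf:
  fixes r :: real
  assumes "0 \<le> r" "r < 1"
  shows "pod.gf 0 r \<le> sigma.gf r"
  using sigma_gf_sums[of r] sum_le_suminf[of "\<lambda>m. real (moex_weight m) * pod.gf m r" "{0}"]
    pod.gf_nonneg[OF assms] assms
  by (simp add: sums_iff moex_weight_def)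

lemma moex_weight_geometric_sums: "(\<lambda>m. real (moex_weight m) * (1 / 2) ^ m) sums 3"
proof -
  have "(\<lambda>m. 2 * (1 / 2) ^ m - (if m = 0 then 1 else 0) :: real) sums (2 * (1 / (1 - 1 / 2)) - 1)"
    using sums_single[of 0 "\<lambda>_. 1 :: real"] by (intro sums_diff sums_mult geometric_sums) auto
  moreover have "2 * (1 / 2) ^ m - (if m = 0 then 1 else 0) = real (moex_weight m) * (1 / 2) ^ m" for m
    by (simp add: moex_weight_def)
  ultimately show ?thesis by simp
qed

lemma pod_gf_0_pos: "0 < t \<Longrightarrow> 0 < pod.gf 0 (exp (- t))" for t :: real
  by (simp add: pod_gf_0_eq)

lemma tendsto_sigma_gf_over_pod_gf:
  "((\<lambda>t. sigma.gf (exp (- t)) / pod.gf 0 (exp (- t))) \<longlongrightarrow> (3 :: real)) (at_right 0)"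
proof -
  have "((\<lambda>t. \<Sum>m. real (moex_weight m) * odd_ratio m (exp (- t))) \<longlongrightarrow> (\<Sum>m. real (moex_weight m) * (1 / 2) ^ m))
          (at_right 0)"
  proof (rule tendsto_suminf_dominated)
    show "((\<lambda>t. real (moex_weight m) * odd_ratio m (exp (- t))) \<longlongrightarrow> real (moex_weight m) * (1 / 2) ^ m)
            (at_right 0)" for m
      by (intro tendsto_intros tendsto_odd_ratio)
    show "\<forall>\<^sub>F t in at_right 0. \<forall>m. norm (real (moex_weight m) * odd_ratio m (exp (- t)))
            \<le> real (moex_weight m) * (1 / 2) ^ m"
      using eventually_at_right_less[of 0]
      by eventually_elim (auto simp: abs_mult odd_ratio_bounds intro!: mult_left_mono)
    show "summable (\<lambda>m. real (moex_weight m) * (1 / 2) ^ m)"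
      using moex_weight_geometric_sums by (rule sums_summable)
  qed simp
  also have "(\<Sum>m. real (moex_weight m) * (1 / 2) ^ m) = 3"
    using moex_weight_geometric_sums by (rule sums_unique[symmetric])
  finally show ?thesis
  proof (rule Lim_transform_eventually)
    show "\<forall>\<^sub>F t in at_right 0. (\<Sum>m. real (moex_weight m) * odd_ratio m (exp (- t)))
        = sigma.gf (exp (- t)) / pod.gf 0 (exp (- t))"
      using eventually_at_right_less[of 0]
    proof eventually_elim
      case (elim t)
      have "(\<lambda>m. real (moex_weight m) * pod.gf m (exp (- t)) / pod.gf 0 (exp (- t)))
          sums (sigma.gf (exp (- t)) / pod.gf 0 (exp (- t)))"
        using sigma_gf_sums[of "exp (- t)"] elim by (intro sums_divide) simp
      moreover have "real (moex_weight m) * pod.gf m (exp (- t)) / pod.gf 0 (exp (- t))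
          = real (moex_weight m) * odd_ratio m (exp (- t))" for m
        using pod_gf_0_pos[OF elim] pod_gf_eq_odd_ratio[of "exp (- t)" m] elim by simp
      ultimately show ?case by (simp add: sums_iff)
    qed
  qed
qed

theorem sigma_gf_asymptotics:
  "(\<lambda>t. sigma.gf (exp (- t))) \<sim>[at_right 0] (\<lambda>t. 3 / sqrt pi * t powr (1 / 2) * exp (pi\<^sup>2 / 8 / t))"
proof -
  have "(\<lambda>t. sigma.gf (exp (- t)) / pod.gf 0 (exp (- t))) \<sim>[at_right 0] (\<lambda>_. 3 :: real)"
    by (rule tendsto_imp_asymp_equiv_const[OF tendsto_sigma_gf_over_pod_gf]) simp
  from asymp_equiv_mult[OF this pod_gf_0_asymptotics] show ?thesis
  proof (rule asymp_equiv_transfer)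
    show "\<forall>\<^sub>F t :: real in at_right 0.
        sigma.gf (exp (- t)) / pod.gf 0 (exp (- t)) * pod.gf 0 (exp (- t)) = sigma.gf (exp (- t))"
      using eventually_at_right_less[of 0]
    proof eventually_elim
      case (elim t)
      show ?case using pod_gf_0_pos[OF elim] by simp
    qed
  qed simp
qed

section \<open>Saddle point bounds\<close>

lemma Jordan_sin_inequality:
  assumes "0 \<le> x" "x \<le> pi / 2"
  shows "2 * x / pi \<le> sin x"
proof -
  have "convex_on {0..pi} (\<lambda>x. - sin x)"
  proof (rule f''_ge0_imp_convex)
    show "((\<lambda>x. - sin x) has_real_derivative - cos x) (at x)" for x
      by (auto intro!: derivative_eq_intros)
    show "((\<lambda>x. - cos x) has_real_derivative sin x) (at x)" for x
      by (auto intro!: derivative_eq_intros)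
  qed (auto intro: sin_ge_zero)
  from convex_onD[OF this, of "2 * x / pi" 0 "pi / 2"] show ?thesis
    using assms by (simp add: field_simps)
qed

lemma one_minus_cos_ge:
  assumes "\<bar>x\<bar> \<le> pi"
  shows "x\<^sup>2 / 8 \<le> 1 - cos x"
proof -
  have "\<bar>x\<bar> / 4 \<le> \<bar>x\<bar> / pi" using pi_less_4 by (intro divide_left_mono) auto
  also have "\<dots> \<le> sin (\<bar>x\<bar> / 2)" using Jordan_sin_inequality[of "\<bar>x\<bar> / 2"] assms by simp
  finally have "(\<bar>x\<bar> / 4)\<^sup>2 \<le> (sin (\<bar>x\<bar> / 2))\<^sup>2" by (intro power_mono) auto
  moreover have "cos (2 * (\<bar>x\<bar> / 2)) = 1 - 2 * (sin (\<bar>x\<bar> / 2))\<^sup>2" by (rule cos_double_sin)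
  ultimately show ?thesis by (simp add: power_divide)
qed

lemma inverse_diff_ge:
  fixes a t v w R :: real
  assumes "0 < a" "a \<le> t" "0 \<le> v" "v \<le> w" "0 < R" "R\<^sup>2 = a\<^sup>2 + w"
  shows "v / (2 * t * (t\<^sup>2 + v)) \<le> 1 / a - 1 / R"
proof -
  have "a \<le> R" by (rule power2_le_imp_le) (use assms in auto)
  have "v / (2 * t * (t\<^sup>2 + v)) = 1 / (2 * t) * (v / (t\<^sup>2 + v))" by simp
  also have "\<dots> \<le> 1 / (2 * a) * (w / (a\<^sup>2 + w))"
  proof (rule mult_mono)
    have "a\<^sup>2 * v \<le> t\<^sup>2 * w" using assms by (intro mult_mono power_mono) auto
    moreover have "0 < t\<^sup>2 + v" "0 < a\<^sup>2 + w" using assms by (auto intro!: add_pos_nonneg)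
    ultimately show "v / (t\<^sup>2 + v) \<le> w / (a\<^sup>2 + w)"
      by (simp add: divide_le_eq pos_le_divide_eq mult.commute) (simp add: field_simps)
  qed (use assms in \<open>auto intro!: frac_le\<close>)
  also have "\<dots> = w / (a * R * (2 * R))" using assms(6) by (simp add: power2_eq_square)
  also have "\<dots> \<le> w / (a * R * (R + a))"
    using assms \<open>a \<le> R\<close> by (intro divide_left_mono mult_left_mono) auto
  also have "w = (R - a) * (R + a)" using assms(6) by (simp add: power2_eq_square algebra_simps)
  also have "(R - a) * (R + a) / (a * R * (R + a)) = (R - a) / (a * R)" using assms by simp
  also have "\<dots> = 1 / a - 1 / R" using assms by (simp add: diff_divide_distrib)
  finally show ?thesis .
qed

lemma pole_gap_rcis_ge:
  fixes t \<theta> :: real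
  assumes t: "0 < t" "t < 1" and \<theta>: "\<bar>\<theta>\<bar> \<le> pi"
  shows "\<theta>\<^sup>2 / (2 * t * (12 * t\<^sup>2 + \<theta>\<^sup>2)) \<le> pole_gap (rcis (exp (- t)) \<theta>)"
proof -
  define r where "r = exp (- t)"
  have r: "0 < r" "r < 1" "1 - r \<le> t" using t exp_ge_add_one_self[of "- t"] by (auto simp: r_def)
  have "1 / 3 \<le> exp (- (1::real))" using e_less_272 by (simp add: exp_minus field_simps)
  also have "\<dots> \<le> r" using t by (simp add: r_def)
  finally have "2 * (1 / 3 * (\<theta>\<^sup>2 / 8)) \<le> 2 * (r * (1 - cos \<theta>))"
    using one_minus_cos_ge[OF \<theta>] r by (intro mult_left_mono mult_mono) auto
  hence "\<theta>\<^sup>2 / 12 \<le> 2 * (r * (1 - cos \<theta>))" by simp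
  moreover have "(norm (1 - rcis r \<theta>))\<^sup>2 = (1 - r)\<^sup>2 + 2 * (r * (1 - cos \<theta>))"
    using r by (simp add: norm_one_minus_squared right_diff_distrib)
  moreover have "0 < norm (1 - rcis r \<theta>)"
    using r norm_triangle_ineq2[of 1 "rcis r \<theta>"] by (simp del: zero_less_norm_iff)
  ultimately have "(\<theta>\<^sup>2 / 12) / (2 * t * (t\<^sup>2 + \<theta>\<^sup>2 / 12)) \<le> 1 / (1 - r) - 1 / norm (1 - rcis r \<theta>)"
    using r by (intro inverse_diff_ge) auto
  moreover have "(\<theta>\<^sup>2 / 12) / (2 * t * (t\<^sup>2 + \<theta>\<^sup>2 / 12)) = \<theta>\<^sup>2 / (2 * t * (12 * t\<^sup>2 + \<theta>\<^sup>2))"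
    using t by (simp add: field_simps)
  moreover have "pole_gap (rcis r \<theta>) = 1 / (1 - r) - 1 / norm (1 - rcis r \<theta>)"
    using r by (simp add: pole_gap_def)
  ultimately show ?thesis by (simp only: r_def)
qed

lemma saddle_decay_pos: "0 < t \<Longrightarrow> 0 < saddle_decay t \<theta>"
  by (simp add: saddle_decay_def add_pos_nonneg)

lemma exp_minus_inverse_le_power:
  fixes k t :: real
  assumes "0 < k" "0 < t" "0 < n"
  shows "exp (- (k / t)) \<le> (real n / k) ^ n * t ^ n"
proof -
  have "k / (real n * t) \<le> exp (k / (real n * t))"
    using exp_ge_add_one_self[of "k / (real n * t)"] by linarith
  hence "(k / (real n * t)) ^ n \<le> exp (k / (real n * t)) ^ n" using assms by (intro power_mono) auto
  also have "exp (k / (real n * t)) ^ n = exp (k / t)" using assms by (simp flip: exp_of_nat_mult)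
  finally have "1 / exp (k / t) \<le> 1 / (k / (real n * t)) ^ n"
    using assms by (intro divide_left_mono) auto
  thus ?thesis using assms by (simp add: exp_minus field_simps power_divide power_mult_distrib)
qed

lemma exp_minus_inverse_le_saddle_decay:
  fixes k t \<theta> :: real
  assumes "0 < k" "0 < t" "t < 1" "\<bar>\<theta>\<bar> \<le> pi"
  shows "exp (- (k / t)) \<le> (3 / k) ^ 3 * 17 * saddle_decay t \<theta>"
proof -
  have "\<theta>\<^sup>2 \<le> 4\<^sup>2" using assms pi_less_4 by (intro abs_le_square_iff[THEN iffD1]) auto
  moreover have "t ^ 3 \<le> 1" using assms by (intro power_le_one) auto
  moreover have "t ^ 3 * (1 + \<theta>\<^sup>2 / t ^ 3) = t ^ 3 + \<theta>\<^sup>2" using assms by (simp add: distrib_left)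
  ultimately have "t ^ 3 * (1 + \<theta>\<^sup>2 / t ^ 3) \<le> 17" by simp
  hence "t ^ 3 \<le> 17 * saddle_decay t \<theta>"
    using saddle_decay_pos[of t \<theta>] assms by (simp add: saddle_decay_def pos_le_divide_eq)
  hence "(3 / k) ^ 3 * t ^ 3 \<le> (3 / k) ^ 3 * (17 * saddle_decay t \<theta>)"
    using assms by (intro mult_left_mono) auto
  thus ?thesis using exp_minus_inverse_le_power[OF assms(1,2), of 3] by simp
qed

lemma exp_pole_gap_le_near:
  fixes c t \<theta> :: real
  assumes c: "0 < c" "c \<le> 1" and t: "0 < t" "t < 1" and \<theta>: "\<bar>\<theta>\<bar> \<le> pi" "\<theta>\<^sup>2 \<le> t\<^sup>2"
  shows "exp (- (c * pole_gap (rcis (exp (- t)) \<theta>))) \<le> 26 / c * saddle_decay t \<theta>"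
proof -
  define z where "z = \<theta>\<^sup>2 / t ^ 3"
  have z: "0 \<le> z" using t by (simp add: z_def)
  have "z / 26 = \<theta>\<^sup>2 / (2 * t * (13 * t\<^sup>2))" by (simp add: z_def power2_eq_square power3_eq_cube)
  also have "\<dots> \<le> \<theta>\<^sup>2 / (2 * t * (12 * t\<^sup>2 + \<theta>\<^sup>2))"
    using \<theta> t by (intro divide_left_mono mult_left_mono mult_pos_pos add_pos_nonneg) auto
  also have "\<dots> \<le> pole_gap (rcis (exp (- t)) \<theta>)" by (rule pole_gap_rcis_ge[OF t \<theta>(1)])
  finally have "c * (z / 26) \<le> c * pole_gap (rcis (exp (- t)) \<theta>)" using c by (intro mult_left_mono) auto
  hence "exp (- (c * pole_gap (rcis (exp (- t)) \<theta>))) \<le> 1 / exp (c * (z / 26))"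
    by (simp add: exp_minus inverse_eq_divide frac_le)
  also have "\<dots> \<le> 1 / (c / 26 * (1 + z))"
  proof (rule divide_left_mono)
    have "c / 26 * (1 + z) \<le> 1 + c * (z / 26)" using c by (simp add: algebra_simps)
    also have "\<dots> \<le> exp (c * (z / 26))" by (rule exp_ge_add_one_self)
    finally show "c / 26 * (1 + z) \<le> exp (c * (z / 26))" .
  qed (use c z in auto)
  finally show ?thesis by (simp add: saddle_decay_def z_def)
qed

lemma exp_pole_gap_le_far:
  fixes c t \<theta> :: real
  assumes c: "0 < c" and t: "0 < t" "t < 1" and \<theta>: "\<bar>\<theta>\<bar> \<le> pi" "t\<^sup>2 \<le> \<theta>\<^sup>2"
  shows "exp (- (c * pole_gap (rcis (exp (- t)) \<theta>))) \<le> (3 / (c / 26)) ^ 3 * 17 * saddle_decay t \<theta>"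
proof -
  have "12 * t\<^sup>2 + \<theta>\<^sup>2 \<le> 13 * \<theta>\<^sup>2" using \<theta> by linarith
  moreover have "0 < 12 * t\<^sup>2 + \<theta>\<^sup>2" using t by (intro add_pos_nonneg) auto
  ultimately have "1 / 13 \<le> \<theta>\<^sup>2 / (12 * t\<^sup>2 + \<theta>\<^sup>2)" by (simp add: pos_le_divide_eq)
  hence "1 / (2 * t) * (1 / 13) \<le> 1 / (2 * t) * (\<theta>\<^sup>2 / (12 * t\<^sup>2 + \<theta>\<^sup>2))"
    using t by (intro mult_left_mono) auto
  also have "\<dots> \<le> pole_gap (rcis (exp (- t)) \<theta>)" using pole_gap_rcis_ge[OF t \<theta>(1)] by simp
  finally have "c * (1 / (2 * t) * (1 / 13)) \<le> c * pole_gap (rcis (exp (- t)) \<theta>)"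
    using c by (intro mult_left_mono) auto
  hence "exp (- (c * pole_gap (rcis (exp (- t)) \<theta>))) \<le> exp (- (c / 26 / t))" by simp
  also have "\<dots> \<le> (3 / (c / 26)) ^ 3 * 17 * saddle_decay t \<theta>"
    using c t \<theta> by (intro exp_minus_inverse_le_saddle_decay) auto
  finally show ?thesis .
qed

lemma exp_pole_gap_le:
  fixes c :: real
  assumes c: "0 < c" "c \<le> 1"
  obtains C where "0 \<le> C" "\<And>t \<theta>. 0 < t \<Longrightarrow> t < 1 \<Longrightarrow> \<bar>\<theta>\<bar> \<le> pi \<Longrightarrow>
    exp (- (c * pole_gap (rcis (exp (- t)) \<theta>))) \<le> C * saddle_decay t \<theta>"
proof
  let ?near = "26 / c" and ?far = "(3 / (c / 26)) ^ 3 * 17"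
  show "0 \<le> ?near + ?far" using c by simp
  fix t \<theta> :: real assume t: "0 < t" "t < 1" "\<bar>\<theta>\<bar> \<le> pi"
  have "0 \<le> ?near * saddle_decay t \<theta>" "0 \<le> ?far * saddle_decay t \<theta>"
    using c saddle_decay_pos[of t \<theta>] t by auto
  moreover consider "\<theta>\<^sup>2 \<le> t\<^sup>2" | "t\<^sup>2 \<le> \<theta>\<^sup>2" by linarith
  hence "exp (- (c * pole_gap (rcis (exp (- t)) \<theta>))) \<le> ?near * saddle_decay t \<theta> \<or>
         exp (- (c * pole_gap (rcis (exp (- t)) \<theta>))) \<le> ?far * saddle_decay t \<theta>"
    using exp_pole_gap_le_near[OF c t] exp_pole_gap_le_far[OF c(1) t] by cases auto
  ultimately show "exp (- (c * pole_gap (rcis (exp (- t)) \<theta>))) \<le> (?near + ?far) * saddle_decay t \<theta>"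
    unfolding distrib_right by linarith
qed

lemma product_decay_le_saddle_decay:
  obtains C where "0 \<le> C" "\<And>m t \<theta>. 0 < t \<Longrightarrow> t < 1 \<Longrightarrow> \<bar>\<theta>\<bar> \<le> pi \<Longrightarrow> real m * t \<le> 1 \<Longrightarrow>
    product_decay m (rcis (exp (- t)) \<theta>) \<le> C * saddle_decay t \<theta>"
proof -
  have "0 < exp (- 3) / (4::real)" "exp (- 3) / (4::real) \<le> 1"
    by (auto intro: order_trans[of _ "1::real"])
  then obtain C where C: "0 \<le> C" "\<And>t \<theta>. 0 < t \<Longrightarrow> t < 1 \<Longrightarrow> \<bar>\<theta>\<bar> \<le> pi \<Longrightarrow>
      exp (- (exp (- 3) / 4 * pole_gap (rcis (exp (- t)) \<theta>))) \<le> C * saddle_decay t \<theta>"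
    by (rule exp_pole_gap_le) blast
  show thesis
  proof (rule that[OF C(1)])
    fix m and t \<theta> :: real
    assume t: "0 < t" "t < 1" "\<bar>\<theta>\<bar> \<le> pi" and m: "real m * t \<le> 1"
    define q where "q = rcis (exp (- t)) \<theta>"
    have q: "norm q = exp (- t)" "norm q < 1" using t by (auto simp: q_def)
    have "exp (- 3) \<le> exp (- (real (2 * m + 1) * t))" using m t by (simp add: algebra_simps)
    also have "\<dots> = norm q ^ (2 * m + 1)" unfolding q(1) by (rule exp_minus_mult_eq_power)
    finally have "exp (- 3) * pole_gap q \<le> norm q ^ (2 * m + 1) * pole_gap q"
      using q(2) by (intro mult_right_mono pole_gap_nonneg) auto
    hence "product_decay m q \<le> exp (- (exp (- 3) / 4 * pole_gap q))" by (simp add: product_decay_def)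
    also have "\<dots> \<le> C * saddle_decay t \<theta>" unfolding q_def by (rule C(2)[OF t])
    finally show "product_decay m (rcis (exp (- t)) \<theta>) \<le> C * saddle_decay t \<theta>" by (simp only: q_def)
  qed
qed

lemma sqrt_half_power_le_saddle_decay:
  obtains C where "0 \<le> C" "\<And>m t \<theta>. 0 < t \<Longrightarrow> t < 1 \<Longrightarrow> \<bar>\<theta>\<bar> \<le> pi \<Longrightarrow> 1 \<le> real m * t \<Longrightarrow>
    sqrt (1 / 2) ^ m \<le> C * saddle_decay t \<theta>"
proof -
  define k :: real where "k = ln 2 / 2"
  have k: "0 < k" by (simp add: k_def)
  have "exp (- k) ^ 2 = 1 / 2" unfolding exp_double[symmetric] by (simp add: k_def exp_minus)
  hence sqrt_half: "sqrt (1 / 2) = exp (- k)" by (metis exp_ge_zero real_sqrt_unique)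
  show thesis
  proof (rule that[of "(3 / k) ^ 3 * 17"])
    fix m and t \<theta> :: real
    assume t: "0 < t" "t < 1" "\<bar>\<theta>\<bar> \<le> pi" and m: "1 \<le> real m * t"
    have "k * (1 / t) \<le> k * real m" using m k t by (intro mult_left_mono) (auto simp: field_simps)
    hence "exp (- (real m * k)) \<le> exp (- (k / t))" by (simp add: mult.commute)
    also have "\<dots> \<le> (3 / k) ^ 3 * 17 * saddle_decay t \<theta>"
      by (rule exp_minus_inverse_le_saddle_decay[OF k t])
    finally show "sqrt (1 / 2) ^ m \<le> (3 / k) ^ 3 * 17 * saddle_decay t \<theta>"
      unfolding sqrt_half exp_minus_mult_eq_power .
  qed (use k in simp)
qed

text \<open>For \<open>m \<le> 1 / t\<close> the decay away from the real axis comes from the product bound, for larger \<open>m\<close>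
  the factor \<open>2 ^ (- m)\<close> is already exponentially small.\<close>
lemma half_power_product_decay_le:
  obtains C where "0 \<le> C" "\<And>m t \<theta>. 0 < t \<Longrightarrow> t < 1 \<Longrightarrow> \<bar>\<theta>\<bar> \<le> pi \<Longrightarrow>
    (1 / 2) ^ m * product_decay m (rcis (exp (- t)) \<theta>) \<le> C * saddle_decay t \<theta> * sqrt (1 / 2) ^ m"
proof -
  obtain B where B: "0 \<le> B" "\<And>m t \<theta>. 0 < t \<Longrightarrow> t < 1 \<Longrightarrow> \<bar>\<theta>\<bar> \<le> pi \<Longrightarrow> real m * t \<le> 1 \<Longrightarrow>
      product_decay m (rcis (exp (- t)) \<theta>) \<le> B * saddle_decay t \<theta>"
    by (rule product_decay_le_saddle_decay) blast
  obtain C where C: "0 \<le> C" "\<And>m t \<theta>. 0 < t \<Longrightarrow> t < 1 \<Longrightarrow> \<bar>\<theta>\<bar> \<le> pi \<Longrightarrow> 1 \<le> real m * t \<Longrightarrow>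
      sqrt (1 / 2) ^ m \<le> C * saddle_decay t \<theta>"
    by (rule sqrt_half_power_le_saddle_decay) blast
  show thesis
  proof (rule that[of "max B C"])
    show "0 \<le> max B C" using B(1) by simp
    fix m and t \<theta> :: real
    assume t: "0 < t" "t < 1" "\<bar>\<theta>\<bar> \<le> pi"
    define D where "D = product_decay m (rcis (exp (- t)) \<theta>)"
    define s :: real where "s = sqrt (1 / 2) ^ m"
    have s: "0 \<le> s" "s \<le> 1" unfolding s_def by (auto intro: power_le_one)
    have D: "0 \<le> D" "D \<le> 1" unfolding D_def using product_decay_bounds t by auto
    have max: "B * saddle_decay t \<theta> \<le> max B C * saddle_decay t \<theta>"
        "C * saddle_decay t \<theta> \<le> max B C * saddle_decay t \<theta>"
      using saddle_decay_pos[of t \<theta>] t by (auto intro: mult_right_mono)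
    have "D \<le> B * saddle_decay t \<theta> \<or> s \<le> C * saddle_decay t \<theta>"
      unfolding D_def s_def using B(2)[OF t] C(2)[OF t] linear by blast
    hence "s * D \<le> max B C * saddle_decay t \<theta>"
      using max mult_left_le_one_le[OF D(1) s] mult_left_le[OF D(2) s(1)] by linarith
    hence "s * D * s \<le> max B C * saddle_decay t \<theta> * s" using s(1) by (rule mult_right_mono)
    moreover have "s * s = (1 / 2) ^ m" unfolding s_def by (simp flip: power_mult_distrib)
    ultimately show "(1 / 2) ^ m * product_decay m (rcis (exp (- t)) \<theta>)
        \<le> max B C * saddle_decay t \<theta> * sqrt (1 / 2) ^ m"
      unfolding D_def[symmetric] s_def[symmetric] by (simp add: mult_ac)
  qed
qed

lemma norm_pod_gf_le_saddle_decay: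
  obtains C where "0 \<le> C" "\<And>m t \<theta>. 0 < t \<Longrightarrow> t < 1 \<Longrightarrow> \<bar>\<theta>\<bar> \<le> pi \<Longrightarrow>
    norm (pod.gf m (rcis (exp (- t)) \<theta>)) \<le> C * pod.gf 0 (exp (- t)) * saddle_decay t \<theta> * sqrt (1 / 2) ^ m"
proof -
  obtain C where C: "0 \<le> C" "\<And>m t \<theta>. 0 < t \<Longrightarrow> t < 1 \<Longrightarrow> \<bar>\<theta>\<bar> \<le> pi \<Longrightarrow>
      (1 / 2) ^ m * product_decay m (rcis (exp (- t)) \<theta>) \<le> C * saddle_decay t \<theta> * sqrt (1 / 2) ^ m"
    by (rule half_power_product_decay_le) blast
  show thesis
  proof (rule that[OF C(1)])
    fix m and t \<theta> :: real
    assume t: "0 < t" "t < 1" "\<bar>\<theta>\<bar> \<le> pi"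
    define r where "r = exp (- t)"
    have r: "0 \<le> r" "r < 1" using t by (auto simp: r_def)
    have "norm (pod.gf m (rcis r \<theta>)) \<le> pod.gf m r * product_decay m (rcis r \<theta>)"
      using norm_pod_gf_le[of "rcis r \<theta>" m] r by simp
    also have "\<dots> = pod.gf 0 r * (odd_ratio m r * product_decay m (rcis r \<theta>))"
      unfolding pod_gf_eq_odd_ratio[OF r, of m] by simp
    also have "\<dots> \<le> pod.gf 0 r * ((1 / 2) ^ m * product_decay m (rcis r \<theta>))"
      using odd_ratio_bounds[OF r] pod.gf_nonneg[OF r] r
      by (intro mult_left_mono mult_right_mono product_decay_bounds) auto
    also have "\<dots> \<le> pod.gf 0 r * (C * saddle_decay t \<theta> * sqrt (1 / 2) ^ m)"
      unfolding r_def using t by (intro mult_left_mono C(2) pod.gf_nonneg) auto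
    finally show "norm (pod.gf m (rcis (exp (- t)) \<theta>))
        \<le> C * pod.gf 0 (exp (- t)) * saddle_decay t \<theta> * sqrt (1 / 2) ^ m"
      by (simp only: r_def mult_ac)
  qed
qed

theorem norm_sigma_gf_le_saddle_decay:
  obtains C where "\<And>t \<theta>. 0 < t \<Longrightarrow> t < 1 \<Longrightarrow> \<bar>\<theta>\<bar> \<le> pi \<Longrightarrow>
    norm (sigma.gf (rcis (exp (- t)) \<theta>)) \<le> C * sigma.gf (exp (- t)) * saddle_decay t \<theta>"
proof -
  obtain C where C: "0 \<le> C" "\<And>m t \<theta>. 0 < t \<Longrightarrow> t < 1 \<Longrightarrow> \<bar>\<theta>\<bar> \<le> pi \<Longrightarrow>
      norm (pod.gf m (rcis (exp (- t)) \<theta>)) \<le> C * pod.gf 0 (exp (- t)) * saddle_decay t \<theta> * sqrt (1 / 2) ^ m"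
    by (rule norm_pod_gf_le_saddle_decay) blast
  define s :: real where "s = sqrt (1 / 2)"
  have s: "0 \<le> s" "s < 1" by (auto simp: s_def real_sqrt_less_iff)
  show thesis
  proof (rule that[of "2 / (1 - s) * C"])
    fix t \<theta> :: real assume t: "0 < t" "t < 1" "\<bar>\<theta>\<bar> \<le> pi"
    define B where "B = C * sigma.gf (exp (- t)) * saddle_decay t \<theta>"
    have pod_bound: "norm (pod.gf m (rcis (exp (- t)) \<theta>)) \<le> B * s ^ m" for m
    proof -
      have "C * pod.gf 0 (exp (- t)) * saddle_decay t \<theta> * s ^ m \<le> B * s ^ m"
        unfolding B_def using C(1) s(1) t less_imp_le[OF saddle_decay_pos[of t \<theta>]]
        by (intro mult_right_mono mult_left_mono pod_gf_0_le_sigma_gf) auto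
      with C(2)[OF t, of m, folded s_def] show ?thesis by (rule order_trans)
    qed
    have "norm (sigma.gf (rcis (exp (- t)) \<theta>)) \<le> 2 * B * (1 / (1 - s))"
    proof (rule norm_sums_le)
      show "(\<lambda>m. of_nat (moex_weight m) * pod.gf m (rcis (exp (- t)) \<theta>)) sums sigma.gf (rcis (exp (- t)) \<theta>)"
        using t by (intro sigma_gf_sums) simp
      show "(\<lambda>m. 2 * B * s ^ m) sums (2 * B * (1 / (1 - s)))"
        using s by (intro sums_mult geometric_sums) auto
      show "norm (of_nat (moex_weight m) * pod.gf m (rcis (exp (- t)) \<theta>)) \<le> 2 * B * s ^ m" for m
        using mult_mono[OF _ pod_bound[of m], of "real (moex_weight m)" 2] moex_weight_le[of m]
        by (simp add: norm_mult)
    qed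
    thus "norm (sigma.gf (rcis (exp (- t)) \<theta>)) \<le> 2 / (1 - s) * C * sigma.gf (exp (- t)) * saddle_decay t \<theta>"
      by (simp add: B_def mult_ac)
  qed
qed

lemma saddle_constants:
  assumes "0 < n"
  shows "3 / sqrt pi / (2 * sqrt (pi * (pi\<^sup>2 / 8))) * (pi\<^sup>2 / 8 / real n) powr (1 / 2 / 2 + 3 / 4)
           * exp (2 * sqrt (pi\<^sup>2 / 8 * real n))
       = 3 * exp (pi * sqrt (real n / 2)) / (4 * sqrt 2 * real n)"
proof -
  have sqrt_8: "sqrt 8 = 2 * sqrt 2" using real_sqrt_mult[of 4 2] by simp
  have "sqrt (pi * (pi\<^sup>2 / 8)) = pi * sqrt pi / (2 * sqrt 2)"
    by (simp add: real_sqrt_mult real_sqrt_divide sqrt_8)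
  moreover have "2 * sqrt (pi\<^sup>2 / 8 * real n) = pi * sqrt (real n / 2)"
    by (simp add: real_sqrt_mult real_sqrt_divide sqrt_8)
  moreover have "(pi\<^sup>2 / 8 / real n) powr (1 / 2 / 2 + 3 / 4) = pi\<^sup>2 / 8 / real n"
    using assms by simp
  moreover have "3 / sqrt pi / (2 * (pi * sqrt pi / (2 * sqrt 2))) * (pi\<^sup>2 / 8 / real n)
      = 3 / (4 * sqrt 2 * real n)"
    using assms by (simp add: field_simps power2_eq_square)
  ultimately show ?thesis by (simp only: times_divide_eq_left)
qed

theorem theorem1p7:
  "(\<lambda>n. real (sigma_od_moex n)) \<sim>[at_top]
     (\<lambda>n. 3 * exp (pi * sqrt (real n / 2)) / (4 * sqrt 2 * real n))"
proof -
  obtain C where C: "\<And>t \<theta>. 0 < t \<Longrightarrow> t < 1 \<Longrightarrow> \<bar>\<theta>\<bar> \<le> pi \<Longrightarrow>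
      norm (sigma.gf (rcis (exp (- t)) \<theta>)) \<le> C * sigma.gf (exp (- t)) * saddle_decay t \<theta>"
    by (rule norm_sigma_gf_le_saddle_decay) blast
  have "\<forall>\<^sub>F t :: real in at_right 0. 0 < t \<and> t < 1"
    using eventually_at_right_real[of 0 1] by simp
  hence "\<forall>\<^sub>F t in at_right 0. \<forall>\<theta>\<in>{-pi..pi}.
      norm (sigma.gf (rcis (exp (- t)) \<theta>)) \<le> C * sigma.gf (exp (- t)) * saddle_decay t \<theta>"
    by eventually_elim (use C in \<open>simp add: abs_le_iff\<close>)
  then interpret saddle_point "\<lambda>n. real (sigma_od_moex n)" "pi\<^sup>2 / 8" "1 / 2" "3 / sqrt pi" C
    using sigma_gf_asymptotics by unfold_locales auto
  from coefficient_asymptotics show ?thesis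
    by (rule asymp_equiv_transfer[OF _ _ eventually_mono[OF eventually_gt_at_top[of 0] saddle_constants]]) simp
qed

end
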